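(* Let $p>1$ and let $V:\mathbb{Z}^N\to\mathbb{R}$ be a potential on the lattice graph $\mathbb{Z}^N$. Assume there exists a $T$-periodic function $V_p:\mathbb{Z}^N\to\mathbb{R}$ (for some positive integer $T$) such that $$-1<\inf_{x\in\mathbb{Z}^N}V(x)\le V(x)\le V_p(x)\quad\text{for all }x\in\mathbb{Z}^N,$$ and $|V(x)-V_p(x)|\to0$ as $|x|\to+\infty$. Then the problem $$-\Delta_pu(x)+V(x)|u|^{p-2}u=|u|^{p-2}u\log|u|^p,\quad x\in\mathbb{Z}^N,$$ has a ground state solution $u$. Moreover, $u(x)>0$ for all $x\in\mathbb{Z}^N$ or $u(x)<0$ for all $x\in\mathbb{Z}^N$.
   Context: In $V_p$ the subscript is a label (for "periodic"), unrelated to the exponent $p$. The lattice graph $\mathbb{Z}^N$ has vertex set $\mathbb{Z}^N$ and edges $\{x,y\}$ with $\sum_{i=1}^N|x_i-y_i|=1$ (written $x\sim y$). A function $g$ on $\mathbb{Z}^N$ is $T$-periodic if $g(x+Te_i)=g(x)$ for all $x\in\mathbb{Z}^N$, $1\le i\le N$, with $e_i$ the $i$-th unit vector. All functions are real valued, $\mu$ is the counting measure, $\int_{\mathbb{Z}^N}f\,d\mu=\sum_xf(x)$. $\Delta_pu(x)=\sum_{y\sim x}|u(y)-u(x)|^{p-2}(u(y)-u(x))$ (with $|t|^{p-2}t=0$ at $t=0$), $|\nabla u(x)|_p=\left(\frac12\sum_{y\sim x}|u(y)-u(x)|^p\right)^{1/p}$. $W^{1,p}(\mathbb{Z}^N)$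 is the completion of the finitely supported functions under $\left(\int(|\nabla u|_p^p+|u|^p)d\mu\right)^{1/p}$; the working space is $X=W^{1,p}(\mathbb{Z}^N)$ with the norm $\left(\int(|\nabla u|_p^p+(V+1)|u|^p)d\mu\right)^{1/p}$. The energy $J:X\to(-\infty,+\infty]$ is $$J(u)=\frac1p\int_{\mathbb{Z}^N}\left(|\nabla u|_p^p+(V(x)+1)|u|^p\right)d\mu-\frac1p\int_{\mathbb{Z}^N}|u|^p\log|u|^p\,d\mu$$ with $0\log0=0$; $D(J)=\{u\in X:J(u)<+\infty\}$. The Nehari manifold is $$\mathcal{N}=\left\{u\in D(J)\setminus\{0\}:\int_{\mathbb{Z}^N}(|\nabla u|_p^p+V|u|^p)\,d\mu=\int_{\mathbb{Z}^N}|u|^p\log|u|^p\,d\mu\right\}.$$ A solution is $u\in D(J)$ satisfying the equation at every vertex; a ground state solution is a nontrivial solution $u$ with $J(u)=\inf_{\mathcal{N}}J$. *)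

theory Defs
  imports "HOL-Analysis.Analysis"
begin

text \<open>
  The lattice \<open>\<int>\<^sup>N\<close> is the type \<open>int ^ 'n\<close> with \<open>N = CARD('n)\<close>.  Since \<open>0 powr a = 0\<close>, the terms
  \<open>\<bar>t\<bar> powr (p - 2) * t\<close> and \<open>\<bar>t\<bar> powr p * ln (\<bar>t\<bar> powr p)\<close> have the conventional value \<open>0\<close>
  at \<open>t = 0\<close>.
\<close>

definition lattice_norm :: "int ^ 'n \<Rightarrow> real" where
  "lattice_norm x = (\<Sum>i\<in>UNIV. \<bar>real_of_int (x $ i)\<bar>)"

definition adjacent :: "int ^ 'n \<Rightarrow> int ^ 'n \<Rightarrow> bool" where
  "adjacent x y \<longleftrightarrow> (\<Sum>i\<in>UNIV. \<bar>x $ i - y $ i\<bar>) = 1"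

lemma finite_adjacent: "finite {y. adjacent x y}" for x :: "int ^ 'n"
proof -
  let ?B = "\<lambda>i. {x $ i - 1 .. x $ i + 1}"
  have "\<bar>x $ i - y $ i\<bar> \<le> 1" if "adjacent x y" for y i
    using member_le_sum[of i UNIV "\<lambda>i. \<bar>x $ i - y $ i\<bar>"] that
    by (simp add: adjacent_def)
  then have "x $ i - 1 \<le> y $ i \<and> y $ i \<le> x $ i + 1" if "adjacent x y" for y i
    using that by (smt (verit))
  then have "{y. adjacent x y} \<subseteq> vec_lambda ` (PiE UNIV ?B)"
    by (auto simp: PiE_def intro!: image_eqI[where x = "vec_nth _"])
  moreover have "finite (PiE UNIV ?B)"
    by (intro finite_PiE) auto
  ultimately show ?thesis
    using finite_surj by blast
qed

definition periodic :: "nat \<Rightarrow> (int ^ 'n \<Rightarrow> real) \<Rightarrow> bool" where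
  "periodic T g \<longleftrightarrow> (\<forall>x i. g (x + int T *s axis i 1) = g x)"

definition p_laplacian :: "real \<Rightarrow> (int ^ 'n \<Rightarrow> real) \<Rightarrow> int ^ 'n \<Rightarrow> real" where
  "p_laplacian p u x = (\<Sum>y | adjacent x y. \<bar>u y - u x\<bar> powr (p - 2) * (u y - u x))"

definition grad_norm :: "real \<Rightarrow> (int ^ 'n \<Rightarrow> real) \<Rightarrow> int ^ 'n \<Rightarrow> real" where
  "grad_norm p u x = (1 / 2 * (\<Sum>y | adjacent x y. \<bar>u y - u x\<bar> powr p)) powr (1 / p)"

definition sobolev_norm :: "real \<Rightarrow> (int ^ 'n \<Rightarrow> real) \<Rightarrow> real" where
  "sobolev_norm p u =
     (\<integral>x. grad_norm p u x powr p + \<bar>u x\<bar> powr p \<partial>count_space UNIV) powr (1 / p)"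

text \<open>
  The completion of the finitely supported functions is realised as a space of functions: the norm
  dominates the value at each vertex, so a Cauchy sequence converges pointwise, and its class in
  the completion is identified with the pointwise limit.  When \<open>V + 1\<close> is bounded and bounded
  away from \<open>0\<close>, the norm with weight \<open>V + 1\<close> is equivalent to this one, so the working
  space \<open>X\<close> has the same elements.
\<close>

definition sobolev_space :: "real \<Rightarrow> (int ^ 'n \<Rightarrow> real) set" where
  "sobolev_space p = {u. \<exists>\<phi> :: nat \<Rightarrow> int ^ 'n \<Rightarrow> real.
     (\<forall>k. finite {x. \<phi> k x \<noteq> 0}) \<and>
     (\<forall>e>0. \<exists>M. \<forall>m\<ge>M. \<forall>n\<ge>M. sobolev_norm p (\<lambda>x. \<phi> m x - \<phi> n x) < e) \<and>
     (\<forall>x. (\<lambda>k. \<phi> k x) \<longlonglongrightarrow> u x)}"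

text \<open>
  Integral against the counting measure with values in the extended reals: positive part minus
  negative part.  On \<open>sobolev_space p\<close> the positive part of \<open>\<bar>u\<bar>\<^sup>p log \<bar>u\<bar>\<^sup>p\<close> has a finite
  integral (\<open>u\<close> tends to \<open>0\<close> at infinity), while its negative part may not.
\<close>

definition lattice_integral :: "(int ^ 'n \<Rightarrow> real) \<Rightarrow> ereal" where
  "lattice_integral f =
     enn2ereal (\<integral>\<^sup>+x. ennreal (f x) \<partial>count_space UNIV) -
     enn2ereal (\<integral>\<^sup>+x. ennreal (- f x) \<partial>count_space UNIV)"

definition energy :: "real \<Rightarrow> (int ^ 'n \<Rightarrow> real) \<Rightarrow> (int ^ 'n \<Rightarrow> real) \<Rightarrow> ereal" where
  "energy p V u =
     ereal (1 / p) * lattice_integral (\<lambda>x. grad_norm p u x powr p + (V x + 1) * \<bar>u x\<bar> powr p) -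
     ereal (1 / p) * lattice_integral (\<lambda>x. \<bar>u x\<bar> powr p * ln (\<bar>u x\<bar> powr p))"

definition energy_domain :: "real \<Rightarrow> (int ^ 'n \<Rightarrow> real) \<Rightarrow> (int ^ 'n \<Rightarrow> real) set" where
  "energy_domain p V = {u \<in> sobolev_space p. energy p V u < \<infinity>}"

definition nehari :: "real \<Rightarrow> (int ^ 'n \<Rightarrow> real) \<Rightarrow> (int ^ 'n \<Rightarrow> real) set" where
  "nehari p V = {u \<in> energy_domain p V - {\<lambda>x. 0}.
     lattice_integral (\<lambda>x. grad_norm p u x powr p + V x * \<bar>u x\<bar> powr p) =
     lattice_integral (\<lambda>x. \<bar>u x\<bar> powr p * ln (\<bar>u x\<bar> powr p))}"

definition solution :: "real \<Rightarrow> (int ^ 'n \<Rightarrow> real) \<Rightarrow> (int ^ 'n \<Rightarrow> real) \<Rightarrow> bool" where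
  "solution p V u \<longleftrightarrow> u \<in> energy_domain p V \<and>
     (\<forall>x. - p_laplacian p u x + V x * \<bar>u x\<bar> powr (p - 2) * u x =
          \<bar>u x\<bar> powr (p - 2) * u x * ln (\<bar>u x\<bar> powr p))"

definition ground_state :: "real \<Rightarrow> (int ^ 'n \<Rightarrow> real) \<Rightarrow> (int ^ 'n \<Rightarrow> real) \<Rightarrow> bool" where
  "ground_state p V u \<longleftrightarrow> solution p V u \<and> u \<noteq> (\<lambda>x. 0) \<and>
     energy p V u = (INF v\<in>nehari p V. energy p V v)"

end

theory Submission
  imports Defs "HOL-Real_Asymp.Real_Asymp" "HOL-Complex_Analysis.Great_Picard"
begin

text \<open>
  Put \<open>W = V + 1\<close>, let \<open>S(u) = \<Sum>\<bar>u\<bar>\<^sup>p\<close>, and let \<open>I(u)\<close> be the sum over all vertices of the edge density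
  plus \<open>W \<bar>u\<bar>\<^sup>p - \<bar>u\<bar>\<^sup>p ln \<bar>u\<bar>\<^sup>p\<close>, so that the energy is \<open>I / p\<close>.  On a lattice the gradient term is bounded by
  the \<open>p\<close>-mass; the working space is therefore \<open>\<ell>\<^sup>p\<close>, and the energy domain consists of those \<open>u\<close> for
  which \<open>\<bar>u\<bar>\<^sup>p ln \<bar>u\<bar>\<^sup>p\<close> is summable.  The Nehari condition becomes \<open>I(u) = S(u)\<close>, and the energy there is
  \<open>S(u) / p\<close>.

  Multiplying \<open>u\<close> by \<open>s\<close> to the power \<open>1 / p\<close> changes \<open>S\<close> to \<open>s S\<close> and \<open>I\<close> to \<open>s I - s (ln s) S\<close>.  If \<open>M\<close> is
  the infimum of \<open>I\<close> on the unit sphere \<open>S = 1\<close>, this homogeneity gives \<open>I(u) \<ge> S(u) (M - ln S(u))\<close>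
  for all nonzero \<open>u\<close>, hence \<open>S(u) \<ge> exp (M - 1)\<close> on the Nehari manifold, and a minimiser of \<open>I\<close> on the
  sphere rescales to a minimiser of the energy on the Nehari manifold.

  On the sphere \<open>\<bar>u\<bar> \<le> 1\<close>, so every term of \<open>I\<close> is nonnegative and \<open>I\<close> is lower semicontinuous under pointwise
  convergence.  What has to be shown is that a minimising sequence loses no mass, and here the
  entropy helps in two ways.  Bounded entropy keeps some value of each function away from \<open>0\<close>
  (\<open>entropy_not_spread\<close>).  Splitting the mass into parts \<open>\<theta>\<close> and \<open>1 - \<theta>\<close> with disjoint supports costs at least
  \<open>2 \<theta> (1 - \<theta>)\<close>, up to the edges between the supports (\<open>splitting_estimate\<close>), so a nonzero pointwise limit
  carries all the mass (\<open>limit_full_mass\<close>).  If the mass escapes to infinity, it is translated back by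
  multiples of the period: the translated potentials have the same infimum \<open>M\<close> and converge to the
  periodic potential, which dominates \<open>W\<close>; the limit function thus has \<open>I \<le> M\<close> for the original potential
  as well (\<open>minimiser_from_shifts\<close>).

  Passing to the absolute value does not increase \<open>I\<close>.  Varying the minimiser at one vertex gives the
  equation at this vertex (\<open>minimiser_solves_equation\<close>), and a nonnegative solution with a zero
  vanishes at all neighbours of the zero, hence everywhere (\<open>nonneg_solution_pos\<close>).
\<close>

section \<open>Powers of absolute values\<close>

lemma abs_diff_powr_le:
  fixes a b p :: real
  assumes "p > 0"
  shows "\<bar>a - b\<bar> powr p \<le> 2 powr p * (\<bar>a\<bar> powr p + \<bar>b\<bar> powr p)"
proof -
  have "\<bar>a - b\<bar> powr p \<le> (2 * max \<bar>a\<bar> \<bar>b\<bar>) powr p"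
    using assms by (intro powr_mono2) auto
  also have "\<dots> = 2 powr p * max \<bar>a\<bar> \<bar>b\<bar> powr p"
    by (simp add: powr_mult)
  also have "max \<bar>a\<bar> \<bar>b\<bar> powr p \<le> \<bar>a\<bar> powr p + \<bar>b\<bar> powr p"
    by (simp add: max_def)
  finally show ?thesis by simp
qed

lemma filterlim_abs_at_0: "filterlim (\<lambda>h::real. \<bar>h\<bar>) (at_right 0) (at 0)"
  by (auto simp: filterlim_at eventually_at intro!: tendsto_eq_intros exI[of _ 1])

text \<open>
  Both \<open>\<bar>s\<bar> powr p\<close> and \<open>\<bar>s\<bar> powr p * ln (\<bar>s\<bar> powr p)\<close> have to be differentiated at \<open>0\<close> as well,
  where the chain rule is not available; there the difference quotient depends, up to sign, only on
  \<open>\<bar>h\<bar>\<close>, so a one-sided limit decides.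
\<close>

lemma DERIV_0_if_abs_quotient_null:
  fixes f g :: "real \<Rightarrow> real"
  assumes "f 0 = 0" and "\<And>h. h \<noteq> 0 \<Longrightarrow> \<bar>f h / h\<bar> = \<bar>g \<bar>h\<bar>\<bar>" and "(g \<longlongrightarrow> 0) (at_right 0)"
  shows "(f has_real_derivative 0) (at 0)"
proof -
  have "((\<lambda>h. g \<bar>h\<bar>) \<longlongrightarrow> 0) (at 0)"
    using filterlim_compose[OF assms(3) filterlim_abs_at_0] .
  then have "((\<lambda>h. \<bar>g \<bar>h\<bar>\<bar>) \<longlongrightarrow> 0) (at 0)"
    using tendsto_rabs_zero by blast
  moreover have "\<forall>\<^sub>F h in at 0. \<bar>g \<bar>h\<bar>\<bar> = \<bar>f h / h\<bar>"
    by (auto simp: eventually_at assms(2) abs_divide[symmetric] simp del: abs_divide intro!: exI[of _ 1])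
  ultimately have "((\<lambda>h. \<bar>f h / h\<bar>) \<longlongrightarrow> 0) (at 0)"
    using tendsto_cong by fast
  then have "((\<lambda>h. f h / h) \<longlongrightarrow> 0) (at 0)"
    by (rule tendsto_rabs_zero_cancel)
  then show ?thesis
    by (simp add: DERIV_def assms(1))
qed

lemma DERIV_abs_powr:
  fixes p s :: real
  assumes "p > 1"
  shows "((\<lambda>s. \<bar>s\<bar> powr p) has_real_derivative p * (\<bar>s\<bar> powr (p - 2) * s)) (at s)"
proof (cases "s = 0")
  case True
  have "((\<lambda>s. \<bar>s\<bar> powr p) has_real_derivative 0) (at 0)"
  proof (rule DERIV_0_if_abs_quotient_null[where g = "\<lambda>h. h powr (p - 1)"])
    show "((\<lambda>h. h powr (p - 1)) \<longlongrightarrow> 0) (at_right 0)"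
      using assms by real_asymp
  qed (auto simp: powr_diff)
  then show ?thesis using True by simp
next
  case False
  have "\<bar>s\<bar> powr (p - 2) * s * \<bar>s\<bar> = \<bar>s\<bar> powr p * sgn s"
    using False powr_add[of "\<bar>s\<bar>" "p - 2" 2]
    by (simp add: sgn_if powr_numeral power2_eq_square abs_if split: if_splits)
  then have "\<bar>s\<bar> powr (p - 2) * s = \<bar>s\<bar> powr p / \<bar>s\<bar> * sgn s"
    using False by (simp add: field_simps)
  moreover have "((\<lambda>s. \<bar>s\<bar> powr p) has_real_derivative p * \<bar>s\<bar> powr (p - 1) * sgn s) (at s)"
  proof -
    have "(abs has_real_derivative sgn s) (at s)"
    proof (cases "s > 0")
      case True
      then show ?thesis
        using has_field_derivative_transform_within_open[of "\<lambda>x. x" 1 s "{0<..}" abs] by auto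
    next
      case neg: False
      have "((\<lambda>x. - x) has_real_derivative - 1) (at s)"
        by (auto intro!: derivative_eq_intros)
      then show ?thesis
        using neg False has_field_derivative_transform_within_open[of "\<lambda>x. - x" "- 1" s "{..<0}" abs]
        by auto
    qed
    then show ?thesis
      using False by (auto intro!: derivative_eq_intros)
  qed
  ultimately show ?thesis
    using False by (simp add: powr_diff mult.assoc)
qed

lemma DERIV_abs_powr_ln:
  fixes p s :: real
  assumes "p > 1"
  shows "((\<lambda>s. \<bar>s\<bar> powr p * ln (\<bar>s\<bar> powr p)) has_real_derivative
           p * (\<bar>s\<bar> powr (p - 2) * s) * (ln (\<bar>s\<bar> powr p) + 1)) (at s)"
proof (cases "s = 0")
  case True
  have "((\<lambda>s. \<bar>s\<bar> powr p * ln (\<bar>s\<bar> powr p)) has_real_derivative 0) (at 0)"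
  proof (rule DERIV_0_if_abs_quotient_null[where g = "\<lambda>h. h powr (p - 1) * (p * ln h)"])
    show "((\<lambda>h. h powr (p - 1) * (p * ln h)) \<longlongrightarrow> 0) (at_right 0)"
      using assms by real_asymp
  qed (auto simp: powr_diff abs_mult)
  then show ?thesis using True by simp
next
  case False
  then have "((\<lambda>t. t * ln t) has_real_derivative ln (\<bar>s\<bar> powr p) + 1) (at (\<bar>s\<bar> powr p))"
    by (auto intro!: derivative_eq_intros)
  from DERIV_chain2[OF this DERIV_abs_powr[OF assms]] show ?thesis
    by (simp add: mult.commute)
qed

section \<open>Sums over the lattice\<close>

lemma adjacent_commute: "adjacent x y \<longleftrightarrow> adjacent y x"
proof -
  have "\<bar>x $ i - y $ i\<bar> = \<bar>y $ i - x $ i\<bar>" for i by simp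
  then show ?thesis by (simp add: adjacent_def)
qed

lemma adjacent_shift [simp]: "adjacent (x + z) (y + z) \<longleftrightarrow> adjacent x y"
  by (simp add: adjacent_def)

lemma sum_neighbours: "(\<Sum>y | adjacent x y. f y) = (\<Sum>z | adjacent 0 z. f (x + z))"
proof -
  have 1: "adjacent 0 (y - x) \<longleftrightarrow> adjacent x y" for y
    using adjacent_shift[of 0 x "y - x"] by simp
  have 2: "adjacent x (x + z) \<longleftrightarrow> adjacent 0 z" for z
    using 1[of "x + z"] by simp
  show ?thesis
    by (rule sum.reindex_bij_witness[where i = "\<lambda>z. x + z" and j = "\<lambda>y. y - x"])
       (auto simp: 1 2)
qed

abbreviation lsummable :: "(int ^ 'n \<Rightarrow> real) \<Rightarrow> bool" where
  "lsummable f \<equiv> integrable (count_space UNIV) f"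

abbreviation lsum :: "(int ^ 'n \<Rightarrow> real) \<Rightarrow> real" where
  "lsum f \<equiv> integral\<^sup>L (count_space UNIV) f"

lemma bij_shift: "bij (\<lambda>x::int ^ 'n. x + z)"
  by (rule bij_betwI[where g = "\<lambda>x. x - z"]) auto

lemma lsummable_shift: "lsummable (\<lambda>x. f (x + z)) \<longleftrightarrow> lsummable f"
  by (rule integrable_bij_count_space[OF bij_shift])

lemma lsum_shift: "lsum (\<lambda>x. f (x + z)) = lsum f"
  by (rule integral_bij_count_space[OF bij_shift])

lemma lsummable_bound:
  assumes "lsummable g" and "\<And>x. \<bar>f x\<bar> \<le> g x"
  shows "lsummable f"
  using assms by (intro Bochner_Integration.integrable_bound[OF assms(1)]) (auto intro: order_trans[OF _ abs_ge_self])

lemma lsum_mono: "lsummable f \<Longrightarrow> lsummable g \<Longrightarrow> (\<And>x. f x \<le> g x) \<Longrightarrow> lsum f \<le> lsum g"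
  by (rule integral_mono)

lemma finite_support_lsum:
  assumes "finite F" and "\<And>x. x \<notin> F \<Longrightarrow> f x = 0"
  shows "lsummable f" and "lsum f = sum f F"
proof -
  have e: "f = (\<lambda>x. \<Sum>a\<in>F. indicator {a} x * f a)"
  proof
    fix x
    have "(\<Sum>a\<in>F. indicator {a} x * f a) = (\<Sum>a\<in>F. if a = x then f a else 0)"
      by (rule sum.cong) auto
    then show "f x = (\<Sum>a\<in>F. indicator {a} x * f a)"
      using assms by simp
  qed
  show "lsummable f"
    by (subst e) (auto intro!: Bochner_Integration.integrable_sum integrable_mult_left
        integrable_real_indicator)
  have fin: "finite {a \<in> UNIV. f a \<noteq> 0}"
    using assms by (auto intro: finite_subset[of _ F])
  show "lsum f = sum f F"
    using lebesgue_integral_count_space_finite_support[OF fin] assms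
    by (simp, intro sum.mono_neutral_left) auto
qed

lemma sum_le_lsum:
  assumes "lsummable f" and "\<And>x. 0 \<le> f x" and "finite F"
  shows "sum f F \<le> lsum f"
proof -
  let ?g = "\<lambda>x. if x \<in> F then f x else 0"
  have "sum f F = sum ?g F" by simp
  also have "\<dots> = lsum ?g"
    by (rule finite_support_lsum(2)[symmetric]) (use assms in auto)
  also have "\<dots> \<le> lsum f"
    by (intro lsum_mono finite_support_lsum(1)[of F] assms(1)) (use assms in auto)
  finally show ?thesis .
qed

text \<open>
  Fatou's lemma, with the upper bound on the sums allowed to vary along the sequence so that
  minimising sequences fit.
\<close>

lemma lsum_Fatou:
  fixes f :: "nat \<Rightarrow> int ^ 'n \<Rightarrow> real"
  assumes int: "\<And>k. lsummable (f k)" and nonneg: "\<And>k x. 0 \<le> f k x"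
    and lim: "\<And>x. (\<lambda>k. f k x) \<longlonglongrightarrow> g x"
    and le: "\<And>k. lsum (f k) \<le> c k" and c: "c \<longlonglongrightarrow> C"
  shows "lsummable g" and "lsum g \<le> C"
proof -
  have g: "0 \<le> g x" for x
    using LIMSEQ_le_const[OF lim] nonneg by blast
  have cpos: "0 \<le> c k" for k
    using le[of k] Bochner_Integration.integral_nonneg[of "count_space UNIV" "f k", OF nonneg]
    by linarith
  have C: "0 \<le> C"
    using LIMSEQ_le_const[OF c] cpos by blast
  have "(\<integral>\<^sup>+ x. ennreal (g x) \<partial>count_space UNIV)
      = (\<integral>\<^sup>+ x. liminf (\<lambda>k. ennreal (f k x)) \<partial>count_space UNIV)"
    by (intro nn_integral_cong lim_imp_Liminf[symmetric] tendsto_ennrealI lim) auto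
  also have "\<dots> \<le> liminf (\<lambda>k. \<integral>\<^sup>+ x. ennreal (f k x) \<partial>count_space UNIV)"
    by (rule nn_integral_liminf) auto
  also have "\<dots> = liminf (\<lambda>k. ennreal (lsum (f k)))"
    by (simp add: nn_integral_eq_integral[OF int] nonneg)
  also have "\<dots> \<le> liminf (\<lambda>k. ennreal (c k))"
    by (intro Liminf_mono always_eventually allI ennreal_leI le)
  also have "\<dots> = ennreal C"
    by (intro lim_imp_Liminf tendsto_ennrealI c) auto
  finally have *: "(\<integral>\<^sup>+ x. ennreal (g x) \<partial>count_space UNIV) \<le> ennreal C" .
  then show "lsummable g"
    by (intro integrableI_nonneg) (auto simp: g less_top intro: le_less_trans)
  then show "lsum g \<le> C"
    using * C by (simp add: nn_integral_eq_integral g)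
qed

lemma lattice_integral_eq_lsum:
  assumes "lsummable f"
  shows "lattice_integral f = ereal (lsum f)"
proof -
  have "(\<integral>\<^sup>+x. ennreal (f x) \<partial>count_space UNIV) \<noteq> \<infinity>" "(\<integral>\<^sup>+x. ennreal (- f x) \<partial>count_space UNIV) \<noteq> \<infinity>"
    using assms by (auto simp: real_integrable_def)
  then show ?thesis
    unfolding lattice_integral_def real_lebesgue_integral_def[OF assms]
    by (cases "\<integral>\<^sup>+x. ennreal (f x) \<partial>count_space UNIV"; cases "\<integral>\<^sup>+x. ennreal (- f x) \<partial>count_space UNIV")
       (auto simp: enn2ereal_ennreal)
qed

definition edge_density :: "real \<Rightarrow> (int ^ 'n \<Rightarrow> real) \<Rightarrow> int ^ 'n \<Rightarrow> real" where
  "edge_density p u x = (\<Sum>y | adjacent x y. \<bar>u y - u x\<bar> powr p) / 2"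

lemma edge_density_nonneg: "0 \<le> edge_density p u x"
  by (auto simp: edge_density_def intro: sum_nonneg)

lemma grad_norm_powr: "p > 0 \<Longrightarrow> grad_norm p u x powr p = edge_density p u x"
  using edge_density_nonneg[of p u x]
  by (simp add: grad_norm_def edge_density_def powr_powr)

definition gradient_bound :: "'n::finite itself \<Rightarrow> real \<Rightarrow> real" where
  "gradient_bound _ p = real (card {z :: int ^ 'n. adjacent 0 z}) * 2 powr p"

text \<open>
  The gradient term is controlled by the \<open>p\<close>-mass, because every vertex has the same finite number
  of neighbours.  This is why the Sobolev space below is just an \<open>\<ell>\<^sup>p\<close> space.
\<close>

lemma edge_density_summable:
  fixes u :: "int ^ 'n \<Rightarrow> real"
  assumes p: "p > 0" and u: "lsummable (\<lambda>x. \<bar>u x\<bar> powr p)"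
  shows "lsummable (edge_density p u)"
    and "lsum (edge_density p u) \<le> gradient_bound TYPE('n) p * lsum (\<lambda>x. \<bar>u x\<bar> powr p)"
proof -
  let ?m = "\<lambda>x. \<bar>u x\<bar> powr p"
  let ?b = "\<lambda>z x. 2 powr p * (\<bar>u (x + z)\<bar> powr p + \<bar>u x\<bar> powr p)"
  have uz: "lsummable (\<lambda>x. \<bar>u (x + z)\<bar> powr p)" "lsum (\<lambda>x. \<bar>u (x + z)\<bar> powr p) = lsum ?m" for z
    using lsummable_shift[of ?m z] u lsum_shift[of ?m z] by auto
  have b: "lsummable (?b z)" "lsum (?b z) = 2 * 2 powr p * lsum ?m" for z
    using u uz by auto
  have i: "lsummable (\<lambda>x. \<bar>u (x + z) - u x\<bar> powr p)" for z
    by (rule lsummable_bound[OF b(1)[of z]]) (use abs_diff_powr_le[OF p] in auto)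
  have le: "lsum (\<lambda>x. \<bar>u (x + z) - u x\<bar> powr p) \<le> 2 * 2 powr p * lsum ?m" for z
  proof -
    have "lsum (\<lambda>x. \<bar>u (x + z) - u x\<bar> powr p) \<le> lsum (?b z)"
      by (intro lsum_mono i b(1) abs_diff_powr_le p)
    then show ?thesis using b(2) by simp
  qed
  have e: "edge_density p u = (\<lambda>x. (\<Sum>z | adjacent 0 z. \<bar>u (x + z) - u x\<bar> powr p) / 2)"
    by (rule ext, subst edge_density_def, subst sum_neighbours) simp
  show "lsummable (edge_density p u)"
    unfolding e using i by auto
  have "lsum (edge_density p u) = (\<Sum>z | adjacent 0 z. lsum (\<lambda>x. \<bar>u (x + z) - u x\<bar> powr p)) / 2"
    unfolding e using i by simp
  also have "\<dots> \<le> (\<Sum>z :: int ^ 'n | adjacent 0 z. 2 * 2 powr p * lsum ?m) / 2"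
    by (intro divide_right_mono sum_mono le) auto
  also have "\<dots> = gradient_bound TYPE('n) p * lsum ?m"
    by (simp add: gradient_bound_def)
  finally show "lsum (edge_density p u) \<le> gradient_bound TYPE('n) p * lsum ?m" .
qed

section \<open>The Sobolev space, the energy and the Nehari manifold\<close>

lemma sobolev_norm_bounds:
  fixes u :: "int ^ 'n \<Rightarrow> real"
  assumes p: "p > 0" and u: "lsummable (\<lambda>x. \<bar>u x\<bar> powr p)"
  shows "lsum (\<lambda>x. \<bar>u x\<bar> powr p) \<le> sobolev_norm p u powr p"
    and "sobolev_norm p u powr p \<le> (gradient_bound TYPE('n) p + 1) * lsum (\<lambda>x. \<bar>u x\<bar> powr p)"
proof -
  note e = edge_density_summable[OF p u]
  have pos: "0 \<le> lsum (edge_density p u)" "0 \<le> lsum (\<lambda>x. \<bar>u x\<bar> powr p)"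
    by (auto intro!: Bochner_Integration.integral_nonneg edge_density_nonneg)
  have "sobolev_norm p u powr p = lsum (\<lambda>x. edge_density p u x + \<bar>u x\<bar> powr p)"
    using p pos e(1) u by (simp add: sobolev_norm_def grad_norm_powr powr_powr)
  also have "\<dots> = lsum (edge_density p u) + lsum (\<lambda>x. \<bar>u x\<bar> powr p)"
    using e(1) u by simp
  finally have *: "sobolev_norm p u powr p = \<dots>" .
  show "lsum (\<lambda>x. \<bar>u x\<bar> powr p) \<le> sobolev_norm p u powr p"
    using * pos by simp
  show "sobolev_norm p u powr p \<le> (gradient_bound TYPE('n) p + 1) * lsum (\<lambda>x. \<bar>u x\<bar> powr p)"
    using * e(2) by (simp add: algebra_simps)
qed

text \<open>
  A Cauchy sequence is bounded in \<open>\<ell>\<^sup>p\<close>, so Fatou's lemma puts its pointwise limit into \<open>\<ell>\<^sup>p\<close>.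
\<close>

lemma lsummable_if_in_sobolev_space:
  fixes u :: "int ^ 'n \<Rightarrow> real"
  assumes p: "p > 0" and u: "u \<in> sobolev_space p"
  shows "lsummable (\<lambda>x. \<bar>u x\<bar> powr p)"
proof -
  obtain \<phi> where fin: "\<And>k. finite {x. \<phi> k x \<noteq> 0}"
    and Cauchy: "\<And>e. e > 0 \<Longrightarrow> \<exists>M. \<forall>m\<ge>M. \<forall>n\<ge>M. sobolev_norm p (\<lambda>x. \<phi> m x - \<phi> n x) < e"
    and lim: "\<And>x. (\<lambda>k. \<phi> k x) \<longlonglongrightarrow> u x"
    using u unfolding sobolev_space_def by blast
  obtain M where M: "\<And>m. m \<ge> M \<Longrightarrow> sobolev_norm p (\<lambda>x. \<phi> m x - \<phi> M x) < 1"
    using Cauchy[of 1] by auto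
  have s: "lsummable (\<lambda>x. \<bar>\<phi> k x\<bar> powr p)" "lsummable (\<lambda>x. \<bar>\<phi> k x - \<phi> l x\<bar> powr p)" for k l
    using finite_support_lsum(1)[OF fin[of k], of "\<lambda>x. \<bar>\<phi> k x\<bar> powr p"]
      finite_support_lsum(1)[OF finite_UnI[OF fin[of k] fin[of l]], of "\<lambda>x. \<bar>\<phi> k x - \<phi> l x\<bar> powr p"]
    by auto
  define c where "c = 2 powr p * (1 + lsum (\<lambda>x. \<bar>\<phi> M x\<bar> powr p))"
  have le: "lsum (\<lambda>x. \<bar>\<phi> (k + M) x\<bar> powr p) \<le> c" for k
  proof -
    let ?d = "\<lambda>x. \<phi> (k + M) x - \<phi> M x"
    have "lsum (\<lambda>x. \<bar>?d x\<bar> powr p) \<le> sobolev_norm p ?d powr p"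
      by (rule sobolev_norm_bounds(1)[OF p s(2)])
    also have "\<dots> \<le> 1 powr p"
      using M[of "k + M"] p by (intro powr_mono2) (auto simp: sobolev_norm_def)
    finally have d: "lsum (\<lambda>x. \<bar>?d x\<bar> powr p) \<le> 1" by simp
    have "lsum (\<lambda>x. \<bar>\<phi> (k + M) x\<bar> powr p)
        \<le> lsum (\<lambda>x. 2 powr p * (\<bar>?d x\<bar> powr p + \<bar>\<phi> M x\<bar> powr p))"
    proof (rule lsum_mono)
      show "\<bar>\<phi> (k + M) x\<bar> powr p \<le> 2 powr p * (\<bar>?d x\<bar> powr p + \<bar>\<phi> M x\<bar> powr p)" for x
        using abs_diff_powr_le[OF p, of "?d x" "- \<phi> M x"] by simp
    qed (use s in auto)
    also have "\<dots> \<le> c"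
      using s d by (simp add: c_def)
    finally show ?thesis .
  qed
  show ?thesis
  proof (rule lsum_Fatou(1)[where f = "\<lambda>k x. \<bar>\<phi> (k + M) x\<bar> powr p" and c = "\<lambda>_. c" and C = c])
    show "(\<lambda>k. \<bar>\<phi> (k + M) x\<bar> powr p) \<longlonglongrightarrow> \<bar>u x\<bar> powr p" for x
      using p LIMSEQ_ignore_initial_segment[OF lim] by (intro tendsto_powr' tendsto_rabs) auto
  qed (use s le in auto)
qed

text \<open>
  The approximating sequence truncates \<open>u\<close> along an enumeration of the lattice; it is Cauchy
  because the tails \<open>t k\<close> of \<open>\<Sum>\<bar>u\<bar>\<^sup>p\<close> tend to \<open>0\<close>.
\<close>

lemma in_sobolev_space_if_lsummable:
  fixes u :: "int ^ 'n \<Rightarrow> real"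
  assumes p: "p > 0" and u: "lsummable (\<lambda>x. \<bar>u x\<bar> powr p)"
  shows "u \<in> sobolev_space p"
proof -
  define \<phi> where "\<phi> k x = (if to_nat x < k then u x else 0)" for k x
  define t where "t k x = (if to_nat x < k then 0 else \<bar>u x\<bar> powr p)" for k and x :: "int ^ 'n"
  define C where "C = gradient_bound TYPE('n) p + 1"
  have C: "C > 0"
    by (simp add: C_def gradient_bound_def add_nonneg_pos)
  have t: "lsummable (t k)" for k
    by (rule lsummable_bound[OF u]) (auto simp: t_def)
  have t0: "(\<lambda>k. lsum (t k)) \<longlonglongrightarrow> lsum (\<lambda>x::int^'n. 0)"
  proof (rule integral_dominated_convergence[OF _ _ u])
    have "(\<lambda>k. t k x) \<longlonglongrightarrow> 0" for x
      by (rule tendsto_eventually, rule eventually_sequentiallyI[of "Suc (to_nat x)"])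
         (auto simp: t_def)
    then show "AE x in count_space UNIV. (\<lambda>k. t k x) \<longlonglongrightarrow> 0" by simp
  qed (auto simp: t_def)
  have "finite {x. \<phi> k x \<noteq> 0}" for k
  proof -
    have "finite (to_nat -` {..<k} :: (int ^ 'n) set)"
      by (rule finite_vimageI) auto
    then show ?thesis
      by (rule finite_subset[rotated]) (auto simp: \<phi>_def split: if_splits)
  qed
  moreover have "\<exists>M. \<forall>m\<ge>M. \<forall>n\<ge>M. sobolev_norm p (\<lambda>x. \<phi> m x - \<phi> n x) < e" if e: "e > 0" for e
  proof -
    have "\<forall>\<^sub>F k in sequentially. lsum (t k) < e powr p / C"
      using order_tendstoD(2)[OF t0, of "e powr p / C"] e C by simp
    then obtain M where M: "lsum (t M) < e powr p / C"
      using eventually_happens'[OF sequentially_bot] by blast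
    have "sobolev_norm p (\<lambda>x. \<phi> m x - \<phi> n x) < e" if mn: "m \<ge> M" "n \<ge> M" for m n
    proof -
      have le: "\<bar>\<phi> m x - \<phi> n x\<bar> powr p \<le> t M x" for x
        using mn by (auto simp: \<phi>_def t_def)
      have i: "lsummable (\<lambda>x. \<bar>\<phi> m x - \<phi> n x\<bar> powr p)"
        by (rule lsummable_bound[OF t[of M]]) (use le in auto)
      have "sobolev_norm p (\<lambda>x. \<phi> m x - \<phi> n x) powr p \<le> C * lsum (\<lambda>x. \<bar>\<phi> m x - \<phi> n x\<bar> powr p)"
        unfolding C_def by (rule sobolev_norm_bounds(2)[OF p i])
      also have "\<dots> \<le> C * lsum (t M)"
        using C by (intro mult_left_mono lsum_mono i t le) auto
      also have "\<dots> < e powr p"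
        using M C by (simp add: field_simps)
      finally show ?thesis
        using powr_mono2[of p e "sobolev_norm p (\<lambda>x. \<phi> m x - \<phi> n x)"] p e by fastforce
    qed
    then show ?thesis by blast
  qed
  moreover have "(\<lambda>k. \<phi> k x) \<longlonglongrightarrow> u x" for x
    by (rule tendsto_eventually, rule eventually_sequentiallyI[of "Suc (to_nat x)"])
       (auto simp: \<phi>_def)
  ultimately show ?thesis
    unfolding sobolev_space_def by blast
qed

abbreviation mass_density :: "real \<Rightarrow> (int ^ 'n \<Rightarrow> real) \<Rightarrow> int ^ 'n \<Rightarrow> real" where
  "mass_density p u x \<equiv> \<bar>u x\<bar> powr p"

definition log_density :: "real \<Rightarrow> (int ^ 'n \<Rightarrow> real) \<Rightarrow> int ^ 'n \<Rightarrow> real" where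
  "log_density p u x = \<bar>u x\<bar> powr p * ln (\<bar>u x\<bar> powr p)"

text \<open>
  For bounded \<open>V\<close> these are the elements of the energy domain: see \<open>energy_domain_iff\<close>.
\<close>

definition finite_entropy :: "real \<Rightarrow> (int ^ 'n \<Rightarrow> real) \<Rightarrow> bool" where
  "finite_entropy p u \<longleftrightarrow> lsummable (mass_density p u) \<and> lsummable (log_density p u)"

text \<open>
  With \<open>W = V + 1\<close> the sum of this density is \<open>p\<close> times the energy.
\<close>

definition energy_density :: "real \<Rightarrow> (int ^ 'n \<Rightarrow> real) \<Rightarrow> (int ^ 'n \<Rightarrow> real) \<Rightarrow> int ^ 'n \<Rightarrow> real" where
  "energy_density p W u x = edge_density p u x + W x * \<bar>u x\<bar> powr p - log_density p u x"

lemma finite_entropyD: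
  assumes "finite_entropy p u"
  shows "lsummable (mass_density p u)" "lsummable (log_density p u)"
  using assms by (auto simp: finite_entropy_def)

lemma lsummable_weight:
  assumes "lsummable f" and "\<And>x. 0 \<le> f x" and "\<And>x. \<bar>W x\<bar> \<le> K"
  shows "lsummable (\<lambda>x. W x * f x)"
proof (rule lsummable_bound[where g = "\<lambda>x. K * f x"])
  show "\<bar>W x * f x\<bar> \<le> K * f x" for x
    using assms(2,3)[of x] by (simp add: abs_mult mult_right_mono)
qed (use assms(1) in simp)

lemma energy_density_summable:
  assumes "p > 0" and "finite_entropy p u" and "\<And>x. \<bar>W x\<bar> \<le> K"
  shows "lsummable (energy_density p W u)"
    and "lsum (energy_density p W u) = lsum (edge_density p u) + lsum (\<lambda>x. W x * \<bar>u x\<bar> powr p)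
           - lsum (log_density p u)"
proof -
  note i = edge_density_summable(1)[OF assms(1) finite_entropyD(1)[OF assms(2)]]
    lsummable_weight[OF finite_entropyD(1)[OF assms(2)] powr_ge_zero assms(3)]
    finite_entropyD(2)[OF assms(2)]
  show "lsummable (energy_density p W u)"
    unfolding energy_density_def[abs_def] using i by simp
  show "lsum (energy_density p W u) = lsum (edge_density p u) + lsum (\<lambda>x. W x * \<bar>u x\<bar> powr p)
           - lsum (log_density p u)"
    unfolding energy_density_def[abs_def] using i by simp
qed

lemma finite_mass_ge_1:
  assumes u: "lsummable (mass_density p u)"
  shows "finite {x. \<bar>u x\<bar> powr p > 1}"
proof (rule ccontr)
  assume inf: "infinite {x. \<bar>u x\<bar> powr p > 1}"
  obtain k :: nat where k: "lsum (mass_density p u) < k"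
    using reals_Archimedean2 by blast
  obtain F where F: "F \<subseteq> {x. \<bar>u x\<bar> powr p > 1}" "card F = k" "finite F"
    using infinite_arbitrarily_large[OF inf] by blast
  have "real k = (\<Sum>x\<in>F. 1)" using F by simp
  also have "\<dots> \<le> sum (mass_density p u) F"
    using F by (intro sum_mono) (auto intro: less_imp_le)
  also have "\<dots> \<le> lsum (mass_density p u)"
    by (rule sum_le_lsum[OF u _ F(3)]) auto
  finally show False using k by simp
qed

lemma mult_ln_nonpos:
  fixes s :: real
  assumes "0 \<le> s" and "s \<le> 1"
  shows "s * ln s \<le> 0"
  using assms by (cases "s = 0") (auto intro: mult_nonneg_nonpos)

text \<open>
  The integrand is positive only where \<open>\<bar>u\<bar> > 1\<close>, hence at finitely many vertices; the only way for
  the sum to be infinite is therefore \<open>-\<infinity>\<close>, which makes the energy \<open>+\<infinity>\<close>.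
\<close>

lemma lattice_integral_log_density:
  assumes u: "lsummable (mass_density p u)"
  shows "lsummable (log_density p u) \<and> lattice_integral (log_density p u) = ereal (lsum (log_density p u))
    \<or> \<not> lsummable (log_density p u) \<and> lattice_integral (log_density p u) = - \<infinity>"
proof (cases "lsummable (log_density p u)")
  case False
  let ?P = "\<integral>\<^sup>+x. ennreal (log_density p u x) \<partial>count_space UNIV"
  let ?N = "\<integral>\<^sup>+x. ennreal (- log_density p u x) \<partial>count_space UNIV"
  have "lsummable (\<lambda>x. max 0 (log_density p u x))"
  proof (rule finite_support_lsum(1)[OF finite_mass_ge_1[OF u]])
    show "max 0 (log_density p u x) = 0" if "x \<notin> {x. \<bar>u x\<bar> powr p > 1}" for x
      using mult_ln_nonpos[of "\<bar>u x\<bar> powr p"] that by (auto simp: log_density_def max_def)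
  qed
  then have "(\<integral>\<^sup>+x. ennreal (max 0 (log_density p u x)) \<partial>count_space UNIV) \<noteq> \<infinity>"
    by (simp add: real_integrable_def)
  moreover have "ennreal (max 0 t) = ennreal t" for t
    by (cases "t \<ge> 0") (auto simp: max_def ennreal_neg)
  ultimately have P: "?P \<noteq> \<infinity>"
    by simp
  then have "?N = \<infinity>"
    using False by (auto simp: real_integrable_def)
  then show ?thesis
    using False P by (cases ?P) (auto simp: lattice_integral_def)
qed (simp add: lattice_integral_eq_lsum)

lemma energy_domain_iff:
  assumes p: "p > 0" and V: "\<And>x. \<bar>V x + 1\<bar> \<le> K"
  shows "u \<in> energy_domain p V \<longleftrightarrow> finite_entropy p u"
    and "finite_entropy p u \<Longrightarrow> energy p V u = ereal (lsum (energy_density p (\<lambda>x. V x + 1) u) / p)"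
proof -
  have *: "energy p V u = ereal (1 / p) * ereal (lsum (edge_density p u) + lsum (\<lambda>x. (V x + 1) * \<bar>u x\<bar> powr p))
      - ereal (1 / p) * lattice_integral (log_density p u)"
    if u: "lsummable (mass_density p u)"
  proof -
    note i = edge_density_summable(1)[OF p u]
      lsummable_weight[OF u powr_ge_zero V]
    show ?thesis
      unfolding energy_def grad_norm_powr[OF p] log_density_def[abs_def]
      by (subst lattice_integral_eq_lsum) (use i in auto)
  qed
  show e: "energy p V u = ereal (lsum (energy_density p (\<lambda>x. V x + 1) u) / p)" if u: "finite_entropy p u"
    using *[OF finite_entropyD(1)[OF u]] energy_density_summable(2)[OF p u V] 
      lattice_integral_eq_lsum[OF finite_entropyD(2)[OF u]]
    by (simp add: diff_divide_distrib)
  have "energy p V u = \<infinity>" if "lsummable (mass_density p u)" "\<not> lsummable (log_density p u)"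
    using *[OF that(1)] lattice_integral_log_density[OF that(1)] that(2) p by simp
  then show "u \<in> energy_domain p V \<longleftrightarrow> finite_entropy p u"
    using e lsummable_if_in_sobolev_space[OF p, of u] in_sobolev_space_if_lsummable[OF p, of u]
    by (auto simp: energy_domain_def finite_entropy_def)
qed

text \<open>
  The extra \<open>\<Sum>\<bar>u\<bar>\<^sup>p\<close> comes from using the weight \<open>V + 1\<close> in place of \<open>V\<close>.  As a consequence the
  energy on the Nehari manifold is \<open>1 / p\<close> times the \<open>p\<close>-mass.
\<close>

lemma nehari_iff:
  assumes p: "p > 0" and V: "\<And>x. \<bar>V x + 1\<bar> \<le> K"
  shows "u \<in> nehari p V \<longleftrightarrow> finite_entropy p u \<and> u \<noteq> (\<lambda>x. 0) \<and>
           lsum (energy_density p (\<lambda>x. V x + 1) u) = lsum (mass_density p u)"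
proof -
  have "lattice_integral (\<lambda>x. grad_norm p u x powr p + V x * \<bar>u x\<bar> powr p) =
     lattice_integral (\<lambda>x. \<bar>u x\<bar> powr p * ln (\<bar>u x\<bar> powr p)) \<longleftrightarrow>
     lsum (energy_density p (\<lambda>x. V x + 1) u) = lsum (mass_density p u)" if u: "finite_entropy p u"
  proof -
    have V': "\<bar>V x\<bar> \<le> K + 1" for x using V[of x] by linarith
    note i = edge_density_summable(1)[OF p finite_entropyD(1)[OF u]] finite_entropyD[OF u]
      lsummable_weight[OF finite_entropyD(1)[OF u] powr_ge_zero V']
    have e: "lsum (\<lambda>x. (V x + 1) * \<bar>u x\<bar> powr p) = lsum (\<lambda>x. V x * \<bar>u x\<bar> powr p) + lsum (mass_density p u)"
      using i by (simp add: algebra_simps)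
    have "lattice_integral (\<lambda>x. grad_norm p u x powr p + V x * \<bar>u x\<bar> powr p) =
       ereal (lsum (edge_density p u) + lsum (\<lambda>x. V x * \<bar>u x\<bar> powr p))"
      unfolding grad_norm_powr[OF p] by (subst lattice_integral_eq_lsum) (use i in auto)
    moreover have "lattice_integral (\<lambda>x. \<bar>u x\<bar> powr p * ln (\<bar>u x\<bar> powr p)) = ereal (lsum (log_density p u))"
      using lattice_integral_eq_lsum[OF i(3)] by (simp add: log_density_def[abs_def])
    ultimately show ?thesis
      unfolding energy_density_summable(2)[OF p u V] e by auto
  qed
  then show ?thesis
    using energy_domain_iff(1)[OF p V, of u] by (auto simp: nehari_def)
qed

section \<open>Rescaling to the unit sphere\<close>

text \<open>
  Parametrised so that the \<open>p\<close>-mass, rather than the norm, is multiplied by \<open>s\<close>.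
\<close>

definition rescale :: "real \<Rightarrow> real \<Rightarrow> (int ^ 'n \<Rightarrow> real) \<Rightarrow> int ^ 'n \<Rightarrow> real" where
  "rescale p s u x = s powr (1 / p) * u x"

lemma rescale_densities:
  assumes "p > 0" and "s > 0"
  shows "mass_density p (rescale p s u) x = s * \<bar>u x\<bar> powr p"
    and "log_density p (rescale p s u) x = s * log_density p u x + s * ln s * \<bar>u x\<bar> powr p"
    and "energy_density p W (rescale p s u) x = s * energy_density p W u x - s * ln s * \<bar>u x\<bar> powr p"
proof -
  have *: "\<bar>s powr (1 / p) * a\<bar> powr p = s * \<bar>a\<bar> powr p" for a
    using assms by (simp add: abs_mult powr_mult powr_powr)
  show m: "mass_density p (rescale p s u) x = s * \<bar>u x\<bar> powr p"
    by (simp add: rescale_def *)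
  show l: "log_density p (rescale p s u) x = s * log_density p u x + s * ln s * \<bar>u x\<bar> powr p"
  proof (cases "u x = 0")
    case False
    then have "ln (s * \<bar>u x\<bar> powr p) = ln s + ln (\<bar>u x\<bar> powr p)"
      using assms ln_mult_pos[of s "\<bar>u x\<bar> powr p"] by simp
    then show ?thesis
      unfolding log_density_def m by (simp only: distrib_left mult.assoc mult.left_commute mult.commute)
  qed (simp add: log_density_def rescale_def)
  have "edge_density p (rescale p s u) x = s * edge_density p u x"
    by (simp add: edge_density_def rescale_def * sum_distrib_left flip: right_diff_distrib)
  then show "energy_density p W (rescale p s u) x = s * energy_density p W u x - s * ln s * \<bar>u x\<bar> powr p"
    unfolding energy_density_def m l by (simp add: algebra_simps)
qed

lemma rescale_integrals:
  assumes "p > 0" and "s > 0" and u: "finite_entropy p u" and W: "\<And>x. \<bar>W x\<bar> \<le> K"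
  shows "finite_entropy p (rescale p s u)"
    and "lsum (mass_density p (rescale p s u)) = s * lsum (mass_density p u)"
    and "lsum (energy_density p W (rescale p s u)) =
           s * lsum (energy_density p W u) - s * ln s * lsum (mass_density p u)"
proof -
  note d = rescale_densities[OF assms(1,2)]
  note i = finite_entropyD[OF u] energy_density_summable(1)[OF assms(1) u W]
  have l: "log_density p (rescale p s u) = (\<lambda>x. s * log_density p u x + s * ln s * \<bar>u x\<bar> powr p)"
    by (rule ext) (rule d)
  have e: "energy_density p W (rescale p s u) = (\<lambda>x. s * energy_density p W u x - s * ln s * \<bar>u x\<bar> powr p)"
    by (rule ext) (rule d)
  show "finite_entropy p (rescale p s u)"
    unfolding finite_entropy_def l d using i by simp
  show "lsum (mass_density p (rescale p s u)) = s * lsum (mass_density p u)"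
    unfolding d using i by simp
  show "lsum (energy_density p W (rescale p s u)) =
           s * lsum (energy_density p W u) - s * ln s * lsum (mass_density p u)"
    unfolding e using i by simp
qed

text \<open>
  The infimum over the unit sphere of \<open>\<ell>\<^sup>p\<close> enters the arguments as a lower bound.  Stated as a
  predicate, this bound can be carried over from \<open>W\<close> to its translates.
\<close>

definition sphere_bound :: "real \<Rightarrow> (int ^ 'n \<Rightarrow> real) \<Rightarrow> real \<Rightarrow> bool" where
  "sphere_bound p W M \<longleftrightarrow>
     (\<forall>v. finite_entropy p v \<and> lsum (mass_density p v) = 1 \<longrightarrow> M \<le> lsum (energy_density p W v))"

text \<open>
  Rescaling \<open>u\<close> to the unit sphere changes the entropy by \<open>ln\<close> of the mass.
\<close>

lemma sphere_bound_homogeneous: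
  assumes "p > 0" and u: "finite_entropy p u" and W: "\<And>x. \<bar>W x\<bar> \<le> K"
    and M: "sphere_bound p W M" and S: "lsum (mass_density p u) > 0"
  shows "lsum (mass_density p u) * (M - ln (lsum (mass_density p u))) \<le> lsum (energy_density p W u)"
proof -
  let ?S = "lsum (mass_density p u)"
  have s: "1 / ?S > 0" using S by simp
  note r = rescale_integrals[OF assms(1) s u W]
  have "M \<le> lsum (energy_density p W (rescale p (1 / ?S) u))"
    using M r S by (auto simp: sphere_bound_def)
  also have "\<dots> = lsum (energy_density p W u) / ?S + ln ?S"
    using r(3) S by (simp add: ln_div)
  finally show ?thesis
    using S by (simp add: field_simps)
qed

lemma mass_density_le_lsum:
  assumes "lsummable (mass_density p u)"
  shows "\<bar>u x\<bar> powr p \<le> lsum (mass_density p u)"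
  using sum_le_lsum[OF assms, of "{x}"] by simp

text \<open>
  On the unit sphere \<open>\<bar>u\<bar> \<le> 1\<close> everywhere, so the entropy term \<open>- \<bar>u\<bar>\<^sup>p ln \<bar>u\<bar>\<^sup>p\<close> is nonnegative too.  This
  is what makes Fatou's lemma applicable to the whole energy.
\<close>

lemma energy_density_nonneg:
  assumes "\<bar>u x\<bar> powr p \<le> 1" and "0 \<le> W x"
  shows "0 \<le> energy_density p W u x"
proof -
  have "log_density p u x \<le> 0"
    using mult_ln_nonpos[of "\<bar>u x\<bar> powr p"] assms(1) by (simp add: log_density_def)
  moreover have "0 \<le> W x * \<bar>u x\<bar> powr p"
    using assms(2) by simp
  ultimately show ?thesis
    using edge_density_nonneg[of p u x] by (simp add: energy_density_def)
qed

text \<open>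
  A function of mass \<open>\<theta> < 1\<close> pays \<open>- \<theta> ln \<theta> \<ge> \<theta> (1 - \<theta>)\<close> on top of its share \<open>\<theta> M\<close> of the infimum.
  The polynomial bound is also valid at \<open>\<theta> = 0\<close> and passes to limits without effort.
\<close>

lemma sphere_bound_strict:
  assumes p: "p > 0" and u: "finite_entropy p u" and W: "\<And>x. 0 \<le> W x" "\<And>x. W x \<le> K"
    and M: "sphere_bound p W M" and S: "lsum (mass_density p u) = \<theta>" and "\<theta> \<le> 1"
  shows "\<theta> * M + \<theta> * (1 - \<theta>) \<le> lsum (energy_density p W u)"
proof (cases "\<theta> > 0")
  case True
  have W': "\<bar>W x\<bar> \<le> K" for x using W by simp
  have "\<theta> * M + \<theta> * (1 - \<theta>) = \<theta> * (M - (\<theta> - 1))"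
    by (simp add: algebra_simps)
  also have "\<dots> \<le> \<theta> * (M - ln \<theta>)"
    using ln_le_minus_one[OF True] True by (intro mult_left_mono) auto
  also have "\<dots> \<le> lsum (energy_density p W u)"
    using sphere_bound_homogeneous[OF p u W' M] S True by simp
  finally show ?thesis .
next
  case False
  have "\<theta> \<ge> 0"
    unfolding S[symmetric] by (rule Bochner_Integration.integral_nonneg) simp
  then have "\<theta> = 0" using False by simp
  moreover have "0 \<le> lsum (energy_density p W u)"
    using mass_density_le_lsum[OF finite_entropyD(1)[OF u]] S \<open>\<theta> \<le> 1\<close> W
    by (intro Bochner_Integration.integral_nonneg energy_density_nonneg) (auto intro: order_trans)
  ultimately show ?thesis by simp
qed

section \<open>Cutting a function into two pieces\<close>

definition cutoff :: "(int ^ 'n) set \<Rightarrow> (int ^ 'n \<Rightarrow> real) \<Rightarrow> int ^ 'n \<Rightarrow> real" where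
  "cutoff F u x = (if x \<in> F then u x else 0)"

text \<open>
  When \<open>u\<close> is cut along the boundary of a set, the terms \<open>\<bar>u x\<bar>\<^sup>p + \<bar>u y\<bar>\<^sup>p\<close> on the cut edges bound the
  increase of the gradient energy.  Here \<open>G\<close> is any finite set containing the endpoints of all cut
  edges.
\<close>

definition crossing_density :: "real \<Rightarrow> (int ^ 'n) set \<Rightarrow> (int ^ 'n \<Rightarrow> real) \<Rightarrow> int ^ 'n \<Rightarrow> real" where
  "crossing_density p G u x =
     (\<Sum>y | adjacent x y. if x \<in> G \<and> y \<in> G then \<bar>u x\<bar> powr p + \<bar>u y\<bar> powr p else 0) / 2"

lemma finite_entropy_cutoff:
  assumes "finite_entropy p u"
  shows "finite_entropy p (cutoff F u)"
proof -
  have "lsummable (mass_density p (cutoff F u))"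
    by (rule lsummable_bound[OF finite_entropyD(1)[OF assms]]) (auto simp: cutoff_def)
  moreover have "lsummable (log_density p (cutoff F u))"
    by (rule lsummable_bound[OF integrable_abs[OF finite_entropyD(2)[OF assms]]])
      (auto simp: cutoff_def log_density_def)
  ultimately show ?thesis by (simp add: finite_entropy_def)
qed

text \<open>
  The potential and entropy terms are exactly additive over disjoint supports; an edge contributes an
  error only if it joins \<open>F\<close> to its complement.
\<close>

lemma energy_density_cutoff_split:
  assumes cross: "\<And>x y. adjacent x y \<Longrightarrow> x \<in> F \<Longrightarrow> y \<notin> F \<Longrightarrow> x \<in> G \<and> y \<in> G"
  shows "energy_density p W (cutoff F u) x + energy_density p W (cutoff (- F) u) x
     \<le> energy_density p W u x + crossing_density p G u x"
proof -
  let ?e = "\<lambda>v y. \<bar>v y - v x\<bar> powr p"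
  have "?e (cutoff F u) y + ?e (cutoff (- F) u) y
      \<le> ?e u y + (if x \<in> G \<and> y \<in> G then \<bar>u x\<bar> powr p + \<bar>u y\<bar> powr p else 0)"
    if "adjacent x y" for y
    using cross[of x y] cross[of y x] that adjacent_commute[of x y]
    by (auto simp: cutoff_def)
  then have "(\<Sum>y | adjacent x y. ?e (cutoff F u) y + ?e (cutoff (- F) u) y)
      \<le> (\<Sum>y | adjacent x y. ?e u y + (if x \<in> G \<and> y \<in> G then \<bar>u x\<bar> powr p + \<bar>u y\<bar> powr p else 0))"
    by (intro sum_mono) auto
  then have "edge_density p (cutoff F u) x + edge_density p (cutoff (- F) u) x
      \<le> edge_density p u x + crossing_density p G u x"
    by (simp add: edge_density_def crossing_density_def sum.distrib)
  then show ?thesis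
    by (auto simp: energy_density_def log_density_def cutoff_def)
qed

text \<open>
  Both pieces of the cut function pay the strict surcharge of \<open>sphere_bound_strict\<close>, hence a function
  that is nearly minimal and is cut along edges where it is small cannot have its mass \<open>\<theta>\<close> in \<open>F\<close> well
  inside \<open>(0, 1)\<close>.
\<close>

lemma splitting_estimate:
  fixes u :: "int ^ 'n \<Rightarrow> real"
  assumes p: "p > 0" and u: "finite_entropy p u" "lsum (mass_density p u) = 1"
    and W: "\<And>x. 0 \<le> W x" "\<And>x. W x \<le> K" and M: "sphere_bound p W M"
    and fin: "finite F" "finite G"
    and cross: "\<And>x y. adjacent x y \<Longrightarrow> x \<in> F \<Longrightarrow> y \<notin> F \<Longrightarrow> x \<in> G \<and> y \<in> G"
  defines "\<theta> \<equiv> sum (mass_density p u) F"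
  shows "2 * (\<theta> * (1 - \<theta>)) \<le> lsum (energy_density p W u) - M + sum (crossing_density p G u) G"
proof -
  note fe = finite_entropy_cutoff[OF u(1)]
  have W': "\<bar>W x\<bar> \<le> K" for x using W by simp
  note i = energy_density_summable(1)[OF p fe W'] energy_density_summable(1)[OF p u(1) W']
  have c: "lsummable (crossing_density p G u)" "lsum (crossing_density p G u) = sum (crossing_density p G u) G"
    by (rule finite_support_lsum[OF fin(2)]; simp add: crossing_density_def)+
  have mF: "lsum (mass_density p (cutoff F u)) = \<theta>"
    using finite_support_lsum(2)[OF fin(1), of "mass_density p (cutoff F u)"]
    by (simp add: cutoff_def \<theta>_def)
  have "mass_density p u = (\<lambda>x. mass_density p (cutoff F u) x + mass_density p (cutoff (- F) u) x)"
    by (auto simp: cutoff_def)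
  then have "1 = lsum (mass_density p (cutoff F u)) + lsum (mass_density p (cutoff (- F) u))"
    using u(2) finite_entropyD(1)[OF fe[of F]] finite_entropyD(1)[OF fe[of "- F"]] by simp
  then have mC: "lsum (mass_density p (cutoff (- F) u)) = 1 - \<theta>"
    using mF by simp
  have \<theta>: "0 \<le> \<theta>" "\<theta> \<le> 1"
    using sum_le_lsum[OF finite_entropyD(1)[OF u(1)] _ fin(1)] u(2) by (auto simp: \<theta>_def sum_nonneg)
  have "\<theta> * M + \<theta> * (1 - \<theta>) \<le> lsum (energy_density p W (cutoff F u))"
    using \<theta> by (intro sphere_bound_strict[OF p fe W M mF])
  moreover have "(1 - \<theta>) * M + (1 - \<theta>) * (1 - (1 - \<theta>)) \<le> lsum (energy_density p W (cutoff (- F) u))"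
    using \<theta> by (intro sphere_bound_strict[OF p fe W M mC]) auto
  moreover have "lsum (energy_density p W (cutoff F u)) + lsum (energy_density p W (cutoff (- F) u))
      \<le> lsum (energy_density p W u) + sum (crossing_density p G u) G"
  proof -
    have "lsum (\<lambda>x. energy_density p W (cutoff F u) x + energy_density p W (cutoff (- F) u) x)
        \<le> lsum (\<lambda>x. energy_density p W u x + crossing_density p G u x)"
      using i c(1) by (intro lsum_mono energy_density_cutoff_split[OF cross]) auto
    then show ?thesis
      using i c by simp
  qed
  ultimately show ?thesis
    by (simp add: algebra_simps)
qed

lemma sum_crossing_density_le:
  fixes G :: "(int ^ 'n) set"
  assumes G: "finite G"
  shows "sum (crossing_density p G u) G
     \<le> real (card {z :: int ^ 'n. adjacent 0 z}) * sum (mass_density p u) G"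
proof -
  let ?D = "real (card {z :: int ^ 'n. adjacent 0 z})"
  let ?a = "\<lambda>x y. if adjacent x y then \<bar>u y\<bar> powr p else 0"
  let ?b = "\<lambda>x y. if adjacent x y then \<bar>u x\<bar> powr p else 0"
  have card: "real (card {y. adjacent x y}) = ?D" for x :: "int ^ 'n"
    using sum_neighbours[of "\<lambda>_. 1::real" x] by simp
  have le: "(\<Sum>y\<in>G. ?b x y) \<le> ?D * \<bar>u x\<bar> powr p" for x
  proof -
    have "(\<Sum>y\<in>G. ?b x y) = (\<Sum>y\<in>{y\<in>G. adjacent x y}. \<bar>u x\<bar> powr p)"
      by (rule sum.inter_filter[OF G, symmetric])
    also have "\<dots> \<le> (\<Sum>y\<in>{y. adjacent x y}. \<bar>u x\<bar> powr p)"
      by (intro sum_mono2 finite_adjacent) auto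
    finally show ?thesis using card[of x] by simp
  qed
  have c: "crossing_density p G u x = (\<Sum>y\<in>G. ?b x y + ?a x y) / 2" if x: "x \<in> G" for x
  proof -
    have "(\<Sum>y | adjacent x y. if x \<in> G \<and> y \<in> G then \<bar>u x\<bar> powr p + \<bar>u y\<bar> powr p else 0)
        = (\<Sum>y\<in>{y. adjacent x y} \<inter> G. \<bar>u x\<bar> powr p + \<bar>u y\<bar> powr p)"
      using x by (simp add: sum.inter_restrict[OF finite_adjacent])
    also have "\<dots> = (\<Sum>y\<in>G. ?b x y + ?a x y)"
      using G by (intro sum.mono_neutral_cong_left) auto
    finally show ?thesis
      by (simp add: crossing_density_def)
  qed
  have "sum (crossing_density p G u) G = (\<Sum>x\<in>G. \<Sum>y\<in>G. ?b x y + ?a x y) / 2"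
    by (subst sum_divide_distrib) (intro sum.cong refl c)
  also have "(\<Sum>x\<in>G. \<Sum>y\<in>G. ?b x y + ?a x y) = (\<Sum>x\<in>G. \<Sum>y\<in>G. ?b x y) + (\<Sum>x\<in>G. \<Sum>y\<in>G. ?a x y)"
    by (simp add: sum.distrib)
  also have "(\<Sum>x\<in>G. \<Sum>y\<in>G. ?a x y) = (\<Sum>x\<in>G. \<Sum>y\<in>G. ?b x y)"
    by (subst sum.swap) (simp add: adjacent_commute)
  also have "((\<Sum>x\<in>G. \<Sum>y\<in>G. ?b x y) + (\<Sum>x\<in>G. \<Sum>y\<in>G. ?b x y)) / 2 = (\<Sum>x\<in>G. \<Sum>y\<in>G. ?b x y)"
    by simp
  also have "\<dots> \<le> (\<Sum>x\<in>G. ?D * \<bar>u x\<bar> powr p)"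
    by (intro sum_mono le)
  finally show ?thesis by (simp add: sum_distrib_left)
qed

lemma lsum_approx_finite:
  fixes f :: "int ^ 'n \<Rightarrow> real"
  assumes f: "lsummable f" and "\<And>x. 0 \<le> f x" and e: "e > 0"
  obtains F where "finite F" "lsum f - e < sum f F"
proof -
  define g where "g k x = (if to_nat x < k then f x else 0)" for k :: nat and x :: "int ^ 'n"
  have "(\<lambda>k. lsum (g k)) \<longlonglongrightarrow> lsum f"
  proof (rule integral_dominated_convergence[OF _ _ f])
    have "(\<lambda>k. g k x) \<longlonglongrightarrow> f x" for x
      by (rule tendsto_eventually, rule eventually_sequentiallyI[of "Suc (to_nat x)"])
         (auto simp: g_def)
    then show "AE x in count_space UNIV. (\<lambda>k. g k x) \<longlonglongrightarrow> f x" by simp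
  qed (use assms(2) in \<open>auto simp: g_def\<close>)
  then have "\<forall>\<^sub>F k in sequentially. lsum f - e < lsum (g k)"
    using order_tendstoD(1)[of _ "lsum f" _ "lsum f - e"] e by simp
  then obtain k where k: "lsum f - e < lsum (g k)"
    using eventually_happens'[OF sequentially_bot] by blast
  let ?F = "to_nat -` {..<k} :: (int ^ 'n) set"
  have fin: "finite ?F"
    by (rule finite_vimageI) auto
  have "lsum (g k) = sum (g k) ?F"
    by (rule finite_support_lsum(2)[OF fin]) (auto simp: g_def)
  also have "\<dots> = sum f ?F"
    by (rule sum.cong) (auto simp: g_def)
  finally show thesis using that[OF fin] k by simp
qed

section \<open>Compactness of minimising sequences\<close>

text \<open>
  If all values of \<open>\<bar>u\<bar>\<^sup>p\<close> were below \<open>exp (- (A + 1))\<close>, each unit of mass would carry more than \<open>A\<close> units of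
  entropy.  This rules out vanishing of minimising sequences.
\<close>

lemma entropy_not_spread:
  assumes u: "finite_entropy p u" and S: "lsum (mass_density p u) = 1"
    and A: "- lsum (log_density p u) \<le> A"
  shows "\<exists>x. exp (- (A + 1)) \<le> \<bar>u x\<bar> powr p"
proof (rule ccontr)
  assume "\<not> ?thesis"
  then have small: "\<bar>u x\<bar> powr p < exp (- (A + 1))" for x
    by (auto simp: not_le)
  have "(A + 1) * \<bar>u x\<bar> powr p \<le> - log_density p u x" for x
  proof (cases "u x = 0")
    case False
    then have "ln (\<bar>u x\<bar> powr p) < ln (exp (- (A + 1)))"
      using small[of x] by (subst ln_less_cancel_iff) auto
    then have "\<bar>u x\<bar> powr p * ln (\<bar>u x\<bar> powr p) \<le> \<bar>u x\<bar> powr p * - (A + 1)"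
      by (intro mult_left_mono) auto
    then show ?thesis by (simp add: log_density_def algebra_simps)
  qed (simp add: log_density_def)
  then have "lsum (\<lambda>x. (A + 1) * \<bar>u x\<bar> powr p) \<le> lsum (\<lambda>x. - log_density p u x)"
    using finite_entropyD[OF u] by (intro lsum_mono) auto
  then show False
    using S A by simp
qed

text \<open>
  Dichotomy is impossible.  The pointwise limit \<open>w\<close> has some mass \<open>S \<in> (0, 1]\<close>; cutting the approximating
  functions around a large finite set, where the tail of \<open>w\<close> is small, the splitting estimate gives
  \<open>S (1 - S) \<le> 0\<close> in the limit.  The potentials may depend on \<open>k\<close>, as they do after translations.
\<close>

lemma limit_full_mass:
  fixes u :: "nat \<Rightarrow> int ^ 'n \<Rightarrow> real"
  assumes p: "p > 0"
    and u: "\<And>k. finite_entropy p (u k)" "\<And>k. lsum (mass_density p (u k)) = 1"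
    and W: "\<And>k x. 0 \<le> W k x" "\<And>k x. W k x \<le> K"
    and M: "\<And>k. sphere_bound p (W k) M"
    and le: "\<And>k. lsum (energy_density p (W k) (u k)) \<le> M + \<epsilon> k" and \<epsilon>: "\<epsilon> \<longlonglongrightarrow> 0"
    and lim: "\<And>x. (\<lambda>k. u k x) \<longlonglongrightarrow> w x" and "w \<noteq> (\<lambda>x. 0)"
  shows "lsummable (mass_density p w)" and "lsum (mass_density p w) = 1"
proof -
  let ?m = "mass_density p w"
  let ?D = "real (card {z :: int ^ 'n. adjacent 0 z})"
  have limp: "(\<lambda>k. \<bar>u k x\<bar> powr p) \<longlonglongrightarrow> \<bar>w x\<bar> powr p" for x
    using p lim by (intro tendsto_powr' tendsto_rabs) auto
  show i: "lsummable ?m"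
    by (rule lsum_Fatou(1)[OF _ _ limp, where c = "\<lambda>_. 1" and C = 1]) (use u finite_entropyD in auto)
  have S1: "lsum ?m \<le> 1"
    by (rule lsum_Fatou(2)[OF _ _ limp, where c = "\<lambda>_. 1" and C = 1]) (use u finite_entropyD in auto)
  obtain x0 where "w x0 \<noteq> 0" using \<open>w \<noteq> (\<lambda>x. 0)\<close> by auto
  then have S0: "lsum ?m > 0"
    using mass_density_le_lsum[OF i, of x0] by (smt (verit) powr_gt_zero zero_less_abs_iff)
  have key: "2 * (lsum ?m * (1 - lsum ?m)) \<le> 0 + e" if e: "e > 0" for e
  proof -
    \<comment> \<open>The boundary terms will cost at most \<open>?D * d\<close>, and replacing the mass of \<open>w\<close> in \<open>F\<close> by its total
      mass at most \<open>2 * d\<close>.\<close>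
    define d where "d = e / (?D + 2)"
    have d: "d > 0" using e by (simp add: d_def add_nonneg_pos)
    obtain F0 where F0: "finite F0" "lsum ?m - d < sum ?m F0"
      using lsum_approx_finite[OF i _ d] by auto
    \<comment> \<open>Adding a layer of neighbours keeps both ends of every cut edge outside \<open>F0\<close>, where \<open>w\<close> has mass
      less than \<open>d\<close>.\<close>
    define F where "F = F0 \<union> (\<Union>x\<in>F0. {y. adjacent x y})"
    define G where "G = (F \<union> (\<Union>x\<in>F. {y. adjacent x y})) - F0"
    have fin: "finite F" "finite G"
      using F0 finite_adjacent by (auto simp: F_def G_def)
    have cross: "x \<in> G \<and> y \<in> G" if "adjacent x y" "x \<in> F" "y \<notin> F" for x y
      using that by (auto simp: F_def G_def)
    let ?\<theta> = "sum ?m F"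
    have "2 * (?\<theta> * (1 - ?\<theta>)) \<le> 0 + sum (crossing_density p G w) G"
    proof (rule LIMSEQ_le)
      show "(\<lambda>k. 2 * (sum (mass_density p (u k)) F * (1 - sum (mass_density p (u k)) F)))
          \<longlonglongrightarrow> 2 * (?\<theta> * (1 - ?\<theta>))"
        by (intro tendsto_intros limp)
      have "(\<lambda>k. crossing_density p G (u k) x) \<longlonglongrightarrow> crossing_density p G w x" for x
        unfolding crossing_density_def
        by (intro tendsto_divide tendsto_const tendsto_sum) (auto intro!: tendsto_intros limp)
      then show "(\<lambda>k. \<epsilon> k + sum (crossing_density p G (u k)) G) \<longlonglongrightarrow> 0 + sum (crossing_density p G w) G"
        by (intro tendsto_add \<epsilon> tendsto_sum)
      have "2 * (sum (mass_density p (u k)) F * (1 - sum (mass_density p (u k)) F))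
          \<le> \<epsilon> k + sum (crossing_density p G (u k)) G" for k
        using splitting_estimate[OF p u(1)[of k] u(2) W(1)[of k] W(2) M fin cross] le[of k] by simp
      then show "\<exists>N. \<forall>k\<ge>N. 2 * (sum (mass_density p (u k)) F * (1 - sum (mass_density p (u k)) F))
          \<le> \<epsilon> k + sum (crossing_density p G (u k)) G" by blast
    qed
    also have "\<dots> \<le> ?D * sum ?m G"
      using sum_crossing_density_le[OF fin(2)] by simp
    also have "\<dots> \<le> ?D * d"
    proof (rule mult_left_mono)
      have "sum ?m G + sum ?m F0 = sum ?m (G \<union> F0)"
        using fin F0 by (intro sum.union_disjoint[symmetric]) (auto simp: G_def)
      also have "\<dots> \<le> lsum ?m"
        using fin F0 by (intro sum_le_lsum i) auto
      finally show "sum ?m G \<le> d" using F0 by simp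
    qed simp
    finally have 1: "2 * (?\<theta> * (1 - ?\<theta>)) \<le> ?D * d" .
    have "sum ?m F0 \<le> ?\<theta>"
      using fin by (intro sum_mono2) (auto simp: F_def)
    then have \<theta>1: "lsum ?m - d \<le> ?\<theta>" using F0 by simp
    have \<theta>2: "?\<theta> \<le> lsum ?m"
      using fin by (intro sum_le_lsum i) auto
    have "(lsum ?m - d) * (1 - lsum ?m) \<le> ?\<theta> * (1 - lsum ?m)"
      using \<theta>1 S1 by (intro mult_right_mono) auto
    also have "\<dots> \<le> ?\<theta> * (1 - ?\<theta>)"
      using \<theta>2 by (intro mult_left_mono sum_nonneg) auto
    finally have "2 * (lsum ?m * (1 - lsum ?m)) \<le> 2 * (?\<theta> * (1 - ?\<theta>)) + 2 * (d * (1 - lsum ?m))"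
      by (simp add: algebra_simps)
    also have "d * (1 - lsum ?m) \<le> d * 1"
      using S0 d by (intro mult_left_mono) auto
    also have "2 * (?\<theta> * (1 - ?\<theta>)) + 2 * (d * 1) \<le> (?D + 2) * d"
      using 1 by (simp add: algebra_simps)
    also have "\<dots> = e"
      using e by (simp add: d_def add_nonneg_eq_0_iff)
    finally show ?thesis by simp
  qed
  have "2 * (lsum ?m * (1 - lsum ?m)) \<le> 0"
    by (rule field_le_epsilon) (rule key)
  then have "1 - lsum ?m \<le> 0"
    using S0 by (simp add: mult_le_0_iff)
  then show "lsum ?m = 1" using S1 by simp
qed

lemma limit_is_minimiser:
  fixes u :: "nat \<Rightarrow> int ^ 'n \<Rightarrow> real"
  assumes p: "p > 1"
    and u: "\<And>k. finite_entropy p (u k)" "\<And>k. lsum (mass_density p (u k)) = 1"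
    and W: "\<And>k x. 0 \<le> W k x" "\<And>k x. W k x \<le> K"
    and M: "\<And>k. sphere_bound p (W k) M"
    and le: "\<And>k. lsum (energy_density p (W k) (u k)) \<le> M + \<epsilon> k" and \<epsilon>: "\<epsilon> \<longlonglongrightarrow> 0"
    and lim: "\<And>x. (\<lambda>k. u k x) \<longlonglongrightarrow> w x" and w: "w \<noteq> (\<lambda>x. 0)"
    and W': "\<And>x. (\<lambda>k. W k x) \<longlonglongrightarrow> W' x"
  shows "finite_entropy p w" and "lsum (mass_density p w) = 1" and "lsum (energy_density p W' w) \<le> M"
proof -
  have p0: "p > 0" using p by simp
  have full: "lsummable (mass_density p w)"
    by (rule limit_full_mass(1)[where u = u and W = W and K = K and M = M and \<epsilon> = \<epsilon> and w = w]; fact p0 u W M le \<epsilon> lim w)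
  show "lsum (mass_density p w) = 1"
    by (rule limit_full_mass(2)[where u = u and W = W and K = K and M = M and \<epsilon> = \<epsilon> and w = w]; fact p0 u W M le \<epsilon> lim w)
  have limp: "(\<lambda>k. \<bar>u k x\<bar> powr p) \<longlonglongrightarrow> \<bar>w x\<bar> powr p" for x
    using p lim by (intro tendsto_powr' tendsto_rabs) auto
  have liml: "(\<lambda>k. log_density p (u k) x) \<longlonglongrightarrow> log_density p w x" for x
    unfolding log_density_def
    using isCont_tendsto_compose[OF DERIV_isCont[OF DERIV_abs_powr_ln[OF p, of "w x"]] lim[of x]] .
  have "(\<lambda>k. edge_density p (u k) x) \<longlonglongrightarrow> edge_density p w x" for x
    unfolding edge_density_def using p lim
    by (intro tendsto_divide tendsto_const tendsto_sum tendsto_powr' tendsto_rabs tendsto_diff) auto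
  then have limd: "(\<lambda>k. energy_density p (W k) (u k) x) \<longlonglongrightarrow> energy_density p W' w x" for x
    unfolding energy_density_def by (intro tendsto_intros limp liml W')
  have int: "lsummable (energy_density p (W k) (u k))" for k
    by (rule energy_density_summable(1)[OF p0 u(1), where K = K]) (use W in simp)
  have nonneg: "0 \<le> energy_density p (W k) (u k) x" for k x
    using mass_density_le_lsum[OF finite_entropyD(1)[OF u(1)[of k]], of x] u(2)[of k] W
    by (intro energy_density_nonneg) auto
  have limM: "(\<lambda>k. M + \<epsilon> k) \<longlonglongrightarrow> M"
    using tendsto_add[OF tendsto_const[of M] \<epsilon>] by simp
  have d: "lsummable (energy_density p W' w)"
    by (rule lsum_Fatou(1)[where f = "\<lambda>k. energy_density p (W k) (u k)" and c = "\<lambda>k. M + \<epsilon> k"];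
        fact int nonneg limd le limM)
  show "lsum (energy_density p W' w) \<le> M"
    by (rule lsum_Fatou(2)[where f = "\<lambda>k. energy_density p (W k) (u k)" and c = "\<lambda>k. M + \<epsilon> k"];
        fact int nonneg limd le limM)
  have W'b: "\<bar>W' x\<bar> \<le> K" for x
  proof -
    have "0 \<le> W' x"
      by (rule LIMSEQ_le_const[OF W']) (use W(1) in blast)
    moreover have "W' x \<le> K"
      by (rule LIMSEQ_le_const2[OF W']) (use W(2) in blast)
    ultimately show ?thesis by simp
  qed
  note i = edge_density_summable(1)[OF p0 full] lsummable_weight[OF full powr_ge_zero W'b] d
  have "log_density p w = (\<lambda>x. edge_density p w x + W' x * \<bar>w x\<bar> powr p - energy_density p W' w x)"
    by (rule ext) (simp add: energy_density_def)
  then show "finite_entropy p w"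
    using full i by (simp add: finite_entropy_def)
qed

section \<open>Periodicity and translations\<close>

lemma periodic_axis:
  assumes "periodic T g"
  shows "g (x + (int T * k) *s axis i 1) = g x"
proof (induction k rule: int_induct[where k = 0])
  case base
  then show ?case by simp
next
  case (step1 k)
  have "x + (int T * (k + 1)) *s axis i 1 = (x + (int T * k) *s axis i 1) + int T *s axis i 1"
    by (simp add: vec_eq_iff algebra_simps)
  then show ?case
    using step1 assms unfolding periodic_def by metis
next
  case (step2 k)
  have "x + (int T * k) *s axis i 1 = (x + (int T * (k - 1)) *s axis i 1) + int T *s axis i 1"
    by (simp add: vec_eq_iff algebra_simps)
  then show ?case
    using step2 assms unfolding periodic_def by metis
qed

lemma periodic_shift:
  fixes z :: "int ^ 'n"
  assumes "periodic T g"
  shows "g (x + int T *s z) = g x"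
proof -
  have "g (x + (\<Sum>i\<in>I. (int T * z $ i) *s axis i 1)) = g x" if "finite I" for I
    using that
  proof induction
    case (insert i I)
    have e: "x + (\<Sum>i\<in>insert i I. (int T * z $ i) *s axis i 1)
        = (x + (\<Sum>i\<in>I. (int T * z $ i) *s axis i 1)) + (int T * z $ i) *s axis i 1"
      using insert by (simp add: algebra_simps)
    show ?case
      unfolding e periodic_axis[OF assms] by (rule insert.IH)
  qed simp
  from this[of UNIV] have "g (x + (\<Sum>i\<in>UNIV. (int T * z $ i) *s axis i 1)) = g x"
    by simp
  moreover have "(\<Sum>i\<in>UNIV. (int T * z $ i) *s axis i 1) = int T *s z"
    using basis_expansion[of "int T *s z"] by simp
  ultimately show ?thesis by simp
qed

lemma finite_box: "finite {x :: int ^ 'n. \<forall>i. a \<le> x $ i \<and> x $ i \<le> b}"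
proof (rule finite_subset)
  show "{x :: int ^ 'n. \<forall>i. a \<le> x $ i \<and> x $ i \<le> b} \<subseteq> vec_lambda ` (PiE UNIV (\<lambda>_. {a..b}))"
    by (auto simp: PiE_def intro!: image_eqI[where x = "vec_nth _"])
  show "finite (vec_lambda ` (PiE UNIV (\<lambda>_. {a..b})) :: (int ^ 'n) set)"
    by (intro finite_imageI finite_PiE) auto
qed

lemma finite_lattice_norm_ball: "finite {x :: int ^ 'n. lattice_norm x \<le> R}"
proof (rule finite_subset[OF _ finite_box[of "- \<lceil>R\<rceil>" "\<lceil>R\<rceil>"]])
  have "\<bar>x $ i\<bar> \<le> \<lceil>R\<rceil>" if "lattice_norm x \<le> R" for x :: "int ^ 'n" and i
  proof -
    have "\<bar>real_of_int (x $ i)\<bar> \<le> lattice_norm x"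
      using member_le_sum[of i UNIV "\<lambda>i. \<bar>real_of_int (x $ i)\<bar>"] by (simp add: lattice_norm_def)
    then have "real_of_int \<bar>x $ i\<bar> \<le> of_int \<lceil>R\<rceil>"
      using that le_of_int_ceiling[of R] by linarith
    then show ?thesis by linarith
  qed
  then show "{x :: int ^ 'n. lattice_norm x \<le> R} \<subseteq> {x. \<forall>i. - \<lceil>R\<rceil> \<le> x $ i \<and> x $ i \<le> \<lceil>R\<rceil>}"
    by (auto simp: abs_le_iff) (smt (verit))
qed

lemma division_in_box:
  fixes x :: "int ^ 'n"
  assumes "T > 0"
  obtains r z where "\<forall>i. 0 \<le> r $ i \<and> r $ i \<le> int T" and "x = r + int T *s z"
proof (rule that)
  show "x = (\<chi> i. x $ i mod int T) + int T *s (\<chi> i. x $ i div int T)"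
    by (simp add: vec_eq_iff)
  show "\<forall>i. 0 \<le> (\<chi> i. x $ i mod int T) $ i \<and> (\<chi> i. x $ i mod int T) $ i \<le> int T"
    using assms by (auto intro: less_imp_le)
qed

lemma periodic_bounded:
  fixes g :: "int ^ 'n \<Rightarrow> real"
  assumes "periodic T g" and "T > 0"
  shows "\<exists>K. \<forall>x. g x \<le> K"
proof -
  let ?B = "{x :: int ^ 'n. \<forall>i. 0 \<le> x $ i \<and> x $ i \<le> int T}"
  have "g x \<le> Max (g ` ?B)" for x
  proof -
    obtain r z where "r \<in> ?B" "x = r + int T *s z"
      using division_in_box[OF assms(2), of x] by blast
    then show ?thesis
      using periodic_shift[OF assms(1)] by (auto intro!: Max_ge finite_box)
  qed
  then show ?thesis by blast
qed

lemma shift_densities: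
  shows "energy_density p (\<lambda>x. W (x + z)) (\<lambda>x. v (x + z)) = (\<lambda>x. energy_density p W v (x + z))"
    and "log_density p (\<lambda>x. v (x + z)) = (\<lambda>x. log_density p v (x + z))"
proof -
  show l: "log_density p (\<lambda>x. v (x + z)) = (\<lambda>x. log_density p v (x + z))"
    by (simp add: fun_eq_iff log_density_def)
  have "edge_density p (\<lambda>x. v (x + z)) x = edge_density p v (x + z)" for x
    unfolding edge_density_def
    by (subst (1 2) sum_neighbours) (simp add: add_ac)
  then show "energy_density p (\<lambda>x. W (x + z)) (\<lambda>x. v (x + z)) = (\<lambda>x. energy_density p W v (x + z))"
    by (simp add: fun_eq_iff energy_density_def l)
qed

lemma shift_integrals:
  shows "finite_entropy p (\<lambda>x. v (x + z)) \<longleftrightarrow> finite_entropy p v"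
    and "lsum (mass_density p (\<lambda>x. v (x + z))) = lsum (mass_density p v)"
    and "lsum (energy_density p (\<lambda>x. W (x + z)) (\<lambda>x. v (x + z))) = lsum (energy_density p W v)"
proof -
  show "finite_entropy p (\<lambda>x. v (x + z)) \<longleftrightarrow> finite_entropy p v"
    unfolding finite_entropy_def shift_densities
    by (simp only: lsummable_shift[of "mass_density p v"] lsummable_shift[of "log_density p v"])
  show "lsum (mass_density p (\<lambda>x. v (x + z))) = lsum (mass_density p v)"
    by (rule lsum_shift[of "mass_density p v"])
  show "lsum (energy_density p (\<lambda>x. W (x + z)) (\<lambda>x. v (x + z))) = lsum (energy_density p W v)"
    unfolding shift_densities by (rule lsum_shift)
qed

lemma sphere_bound_shift:
  fixes z :: "int ^ 'n"
  assumes "sphere_bound p W M"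
  shows "sphere_bound p (\<lambda>x. W (x + z)) M"
  unfolding sphere_bound_def
proof (intro allI impI)
  fix v :: "int ^ 'n \<Rightarrow> real"
  assume v: "finite_entropy p v \<and> lsum (mass_density p v) = 1"
  let ?v = "\<lambda>x. v (x + - z)"
  have "M \<le> lsum (energy_density p W ?v)"
    using assms v shift_integrals(1,2)[where p = p and v = v and z = "- z"] by (auto simp: sphere_bound_def)
  also have "\<dots> = lsum (energy_density p (\<lambda>x. W (x + z)) v)"
    using shift_integrals(3)[where p = p and W = W and z = z and v = ?v] by simp
  finally show "M \<le> lsum (energy_density p (\<lambda>x. W (x + z)) v)" .
qed

section \<open>Existence of a minimiser on the unit sphere\<close>

text \<open>
  Concentration compactness.  After a translation by \<open>\<zeta> k\<close> the functions keep a fixed amount of mass in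
  a finite set, so they have a nonzero pointwise limit, whose energy for the limit potential \<open>W'\<close> is at most \<open>M\<close>.
  Since all translates of \<open>W\<close> share the bound \<open>M\<close>, the condition \<open>W \<le> W'\<close> turns this limit into a
  minimiser for \<open>W\<close> itself.
\<close>

lemma minimiser_from_shifts:
  fixes v :: "nat \<Rightarrow> int ^ 'n \<Rightarrow> real"
  assumes p: "p > 1" and W: "\<And>x. 0 \<le> W x" "\<And>x. W x \<le> K"
    and M: "sphere_bound p W M"
    and v: "\<And>k. finite_entropy p (v k)" "\<And>k. lsum (mass_density p (v k)) = 1"
    and le: "\<And>k. lsum (energy_density p W (v k)) \<le> M + \<epsilon> k" and \<epsilon>: "\<epsilon> \<longlonglongrightarrow> 0"
    and W': "\<And>x. (\<lambda>k. W (x + \<zeta> k)) \<longlonglongrightarrow> W' x" "\<And>x. W x \<le> W' x"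
    and B: "finite B" "\<And>k. y k \<in> B" and c: "c > 0" "\<And>k. c \<le> \<bar>v k (y k + \<zeta> k)\<bar> powr p"
  obtains w where "finite_entropy p w" "lsum (mass_density p w) = 1" "lsum (energy_density p W w) \<le> M"
proof -
  define u where "u k x = v k (x + \<zeta> k)" for k x
  have p0: "p > 0" using p by simp
  have u: "finite_entropy p (u k)" "lsum (mass_density p (u k)) = 1"
    "lsum (energy_density p (\<lambda>x. W (x + \<zeta> k)) (u k)) \<le> M + \<epsilon> k" for k
    using shift_integrals(1,2)[where p = p and v = "v k" and z = "\<zeta> k"] v le
      shift_integrals(3)[where p = p and v = "v k" and z = "\<zeta> k" and W = W]
    unfolding u_def by simp_all
  have ub: "norm (u k x) \<le> 1" for k x
  proof (rule ccontr)
    assume "\<not> ?thesis"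
    then have "1 powr p < \<bar>u k x\<bar> powr p"
      using p by (intro powr_less_mono2) auto
    then show False
      using mass_density_le_lsum[OF finite_entropyD(1)[OF u(1)[of k]], of x] u(2)[of k] by simp
  qed
  obtain l where l: "strict_mono l" and "\<And>x. x \<in> UNIV \<Longrightarrow> \<exists>a. (\<lambda>k. u (l k) x) \<longlonglongrightarrow> a"
    using function_convergent_subsequence[of UNIV u 1] ub by auto
  then obtain w where w: "\<And>x. (\<lambda>k. u (l k) x) \<longlonglongrightarrow> w x"
    by (metis UNIV_I)
  have w0: "w \<noteq> (\<lambda>x. 0)"
  proof
    assume [simp]: "w = (\<lambda>x. 0)"
    have "(\<lambda>k. \<bar>u (l k) x\<bar> powr p) \<longlonglongrightarrow> \<bar>w x\<bar> powr p" for x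
      using p by (intro tendsto_powr' tendsto_rabs w) auto
    then have "\<forall>\<^sub>F k in sequentially. \<bar>u (l k) x\<bar> powr p < c" for x
      using order_tendstoD(2)[of _ "\<bar>w x\<bar> powr p"] c p by fastforce
    then have "\<forall>\<^sub>F k in sequentially. \<forall>x\<in>B. \<bar>u (l k) x\<bar> powr p < c"
      using B by (intro eventually_ball_finite) auto
    then obtain k where "\<forall>x\<in>B. \<bar>u (l k) x\<bar> powr p < c"
      using eventually_happens'[OF sequentially_bot] by blast
    then show False
      using B(2)[of "l k"] c(2)[of "l k"] by (fastforce simp: u_def)
  qed
  have W'l: "(\<lambda>k. W (x + \<zeta> (l k))) \<longlonglongrightarrow> W' x" for x
    using LIMSEQ_subseq_LIMSEQ[OF W'(1)[of x] l] by (simp add: o_def)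
  have \<epsilon>l: "(\<lambda>k. \<epsilon> (l k)) \<longlonglongrightarrow> 0"
    using LIMSEQ_subseq_LIMSEQ[OF \<epsilon> l] by (simp add: o_def)
  note lm = limit_is_minimiser[where p = p and u = "\<lambda>k. u (l k)" and W = "\<lambda>k x. W (x + \<zeta> (l k))"
      and K = K and M = M and \<epsilon> = "\<lambda>k. \<epsilon> (l k)" and w = w and W' = W',
      OF p u(1,2) W(1) W(2) sphere_bound_shift[OF M] u(3) \<epsilon>l w w0 W'l]
  have W'b: "\<bar>W' x\<bar> \<le> K" for x
  proof -
    have "0 \<le> W' x"
      by (rule LIMSEQ_le_const[OF W'(1)]) (use W(1) in blast)
    moreover have "W' x \<le> K"
      by (rule LIMSEQ_le_const2[OF W'(1)]) (use W(2) in blast)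
    ultimately show ?thesis by simp
  qed
  have Wb: "\<bar>W x\<bar> \<le> K" for x using W by simp
  have "lsum (energy_density p W w) \<le> lsum (energy_density p W' w)"
    using W'(2)
    by (intro lsum_mono[OF energy_density_summable(1)[OF p0 lm(1) Wb] energy_density_summable(1)[OF p0 lm(1) W'b]])
      (auto simp: energy_density_def intro!: mult_right_mono)
  then show thesis
    using that lm by simp
qed

lemma ex_sphere_infimum:
  fixes W :: "int ^ 'n \<Rightarrow> real"
  assumes p: "p > 0" and W: "\<And>x. 0 \<le> W x"
  obtains M v where "sphere_bound p W M" and "\<And>k. finite_entropy p (v k)"
    "\<And>k. lsum (mass_density p (v k)) = 1"
    "\<And>k::nat. lsum (energy_density p W (v k)) \<le> M + 1 / (real k + 1)"
proof -
  define U where "U = {v :: int ^ 'n \<Rightarrow> real. finite_entropy p v \<and> lsum (mass_density p v) = 1}"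
  let ?I = "\<lambda>v. lsum (energy_density p W v)"
  define M where "M = Inf (?I ` U)"
  have "0 \<le> ?I v" if "v \<in> U" for v
  proof (rule Bochner_Integration.integral_nonneg, rule energy_density_nonneg)
    show "\<bar>v x\<bar> powr p \<le> 1" for x
      using that mass_density_le_lsum[where p = p and u = v and x = x] by (auto simp: U_def finite_entropy_def)
  qed (use W in auto)
  then have bdd: "bdd_below (?I ` U)"
    by (auto simp: bdd_below_def)
  let ?d = "\<lambda>x :: int ^ 'n. if x = 0 then 1 else 0 :: real"
  have "?d \<in> U"
    using finite_support_lsum[of "{0}" "mass_density p ?d"] finite_support_lsum(1)[of "{0}" "log_density p ?d"]
    by (simp add: U_def finite_entropy_def log_density_def)
  then have ne: "?I ` U \<noteq> {}" by blast
  have M: "sphere_bound p W M"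
    unfolding sphere_bound_def M_def using bdd by (auto simp: U_def intro!: cInf_lower)
  have "\<exists>v. v \<in> U \<and> ?I v \<le> M + 1 / (real k + 1)" for k
  proof -
    have "Inf (?I ` U) < M + 1 / (real k + 1)"
      by (simp add: M_def add_pos_nonneg)
    from cInf_lessD[OF ne this] obtain v where "v \<in> U" "?I v < M + 1 / (real k + 1)"
      by auto
    then show ?thesis by (intro exI[of _ v]) simp
  qed
  then obtain v where "\<And>k. v k \<in> U" "\<And>k. ?I (v k) \<le> M + 1 / (real k + 1)"
    by metis
  then show thesis
    by (intro that[OF M, of v]) (auto simp: U_def)
qed

lemma filterlim_lattice_norm_shift:
  fixes z :: "nat \<Rightarrow> int ^ 'n"
  assumes T: "T > 0" and fin: "\<And>a. finite {k. z k = a}"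
  shows "filterlim (\<lambda>k. lattice_norm (x + int T *s z k)) at_top sequentially"
  unfolding filterlim_at_top
proof
  fix R
  let ?A = "{a. lattice_norm (x + int T *s a) \<le> R}"
  have "finite ((\<lambda>a. x + int T *s a) -` {x. lattice_norm x \<le> R})"
    using T by (intro finite_vimageI finite_lattice_norm_ball) (auto simp: inj_on_def vec_eq_iff)
  then have "finite ?A" by (simp add: vimage_def)
  then have "finite (\<Union>a\<in>?A. {k. z k = a})"
    using fin by blast
  then have "finite {k. \<not> R < lattice_norm (x + int T *s z k)}"
    by (rule finite_subset[rotated]) (auto simp: not_less)
  then have "\<forall>\<^sub>F k in sequentially. R < lattice_norm (x + int T *s z k)"
    by (simp only: cofinite_eq_sequentially[symmetric] eventually_cofinite)
  then show "\<forall>\<^sub>F k in sequentially. R \<le> lattice_norm (x + int T *s z k)"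
    by eventually_elim auto
qed

text \<open>
  A minimising sequence has a point \<open>x k\<close> at which it is not small.  Modulo \<open>T\<close> these points lie in a
  finite box.  Either \<open>x k\<close> stays in one translate of this box infinitely often, and nothing is
  translated, or the points escape to infinity, and the potential seen from them converges to \<open>W'\<close>.
\<close>

lemma ex_minimiser_on_sphere:
  fixes W W' :: "int ^ 'n \<Rightarrow> real"
  assumes p: "p > 1" and T: "T > 0" and per: "periodic T W'"
    and W: "\<And>x. 0 \<le> W x" "\<And>x. W x \<le> K" "\<And>x. W x \<le> W' x"
    and lim: "((\<lambda>x. \<bar>W x - W' x\<bar>) \<longlongrightarrow> 0) (filtercomap lattice_norm at_top)"
  obtains M w where "sphere_bound p W M" "finite_entropy p w" "lsum (mass_density p w) = 1"
    "lsum (energy_density p W w) \<le> M"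
proof -
  have p0: "p > 0" using p by simp
  obtain M v where M: "sphere_bound p W M"
    and v: "\<And>k. finite_entropy p (v k)" "\<And>k. lsum (mass_density p (v k)) = 1"
    and le: "\<And>k::nat. lsum (energy_density p W (v k)) \<le> M + 1 / (real k + 1)"
    using ex_sphere_infimum[where W = W, OF p0 W(1)] by blast
  define c where "c = exp (- (M + 1 + 1))"
  have c: "c > 0" by (simp add: c_def)
  have "\<exists>x. c \<le> \<bar>v k x\<bar> powr p" for k
    unfolding c_def
  proof (rule entropy_not_spread[OF v])
    have "0 \<le> lsum (edge_density p (v k))" "0 \<le> lsum (\<lambda>x. W x * \<bar>v k x\<bar> powr p)"
      using W by (auto intro!: Bochner_Integration.integral_nonneg edge_density_nonneg)
    moreover have "lsum (energy_density p W (v k)) =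
        lsum (edge_density p (v k)) + lsum (\<lambda>x. W x * \<bar>v k x\<bar> powr p) - lsum (log_density p (v k))"
      by (rule energy_density_summable(2)[OF p0 v(1), where K = K]) (use W in simp)
    moreover have "1 / (real k + 1) \<le> 1" by simp
    ultimately show "- lsum (log_density p (v k)) \<le> M + 1"
      using le[of k] by linarith
  qed
  then obtain x where x: "\<And>k. c \<le> \<bar>v k (x k)\<bar> powr p" by metis
  define B where "B = {r :: int ^ 'n. \<forall>i. 0 \<le> r $ i \<and> r $ i \<le> int T}"
  have finB: "finite B"
    unfolding B_def by (rule finite_box)
  have "\<exists>r z. r \<in> B \<and> x k = r + int T *s z" for k
    using division_in_box[OF T, of "x k"] unfolding B_def by blast
  then obtain r z where r: "\<And>k. r k \<in> B" and xk: "\<And>k. x k = r k + int T *s z k"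
    by metis
  have \<epsilon>: "(\<lambda>k. 1 / (real k + 1)) \<longlonglongrightarrow> 0"
    by real_asymp
  show thesis
  proof (cases "\<exists>a. infinite {k. z k = a}")
    case True
    then obtain a where a: "infinite {k. z k = a}" by blast
    obtain s where s: "strict_mono (s :: nat \<Rightarrow> nat)" "\<And>k. s k \<in> {k. z k = a}"
      using infinite_enumerate[OF a] by blast
    have \<epsilon>s: "(\<lambda>k. 1 / (real (s k) + 1)) \<longlonglongrightarrow> 0"
      using LIMSEQ_subseq_LIMSEQ[OF \<epsilon> s(1)] by (simp add: o_def)
    have fin: "finite ((\<lambda>r. r + int T *s a) ` B)"
      by (intro finite_imageI finB)
    have mem: "x (s k) \<in> (\<lambda>r. r + int T *s a) ` B" for k
      using r[of "s k"] xk[of "s k"] s(2)[of k] by auto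
    have lb: "c \<le> \<bar>v (s k) (x (s k) + 0)\<bar> powr p" for k
      using x by simp
    have W0: "(\<lambda>k. W (y + 0)) \<longlonglongrightarrow> W y" for y by simp
    obtain w where "finite_entropy p w" "lsum (mass_density p w) = 1" "lsum (energy_density p W w) \<le> M"
      using minimiser_from_shifts[where v = "\<lambda>k. v (s k)" and y = "\<lambda>k. x (s k)" and \<zeta> = "\<lambda>_. 0"
          and W = W and W' = W and \<epsilon> = "\<lambda>k. 1 / (real (s k) + 1)",
          OF p W(1,2) M v(1) v(2) le \<epsilon>s W0 order_refl fin mem c lb] by blast
    then show thesis using that M by blast
  next
    case False
    have conv: "(\<lambda>k. W (y + int T *s z k)) \<longlonglongrightarrow> W' y" for y
    proof -
      have "filterlim (\<lambda>k. y + int T *s z k) (filtercomap lattice_norm at_top) sequentially"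
        unfolding filterlim_filtercomap_iff o_def
        by (rule filterlim_lattice_norm_shift[OF T]) (use False in blast)
      from filterlim_compose[OF lim this]
      have "(\<lambda>k. W (y + int T *s z k) - W' y) \<longlonglongrightarrow> 0"
        unfolding periodic_shift[OF per] by (rule tendsto_rabs_zero_cancel)
      then show ?thesis
        by (simp add: LIM_zero_iff)
    qed
    have lb: "c \<le> \<bar>v k (r k + int T *s z k)\<bar> powr p" for k
      using x[of k] xk by simp
    obtain w where "finite_entropy p w" "lsum (mass_density p w) = 1" "lsum (energy_density p W w) \<le> M"
      using minimiser_from_shifts[where v = v and y = r and \<zeta> = "\<lambda>k. int T *s z k"
          and W = W and W' = W' and \<epsilon> = "\<lambda>k. 1 / (real k + 1)",
          OF p W(1,2) M v le \<epsilon> conv W(3) finB r c lb] by blast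
    then show thesis using that M by blast
  qed
qed

section \<open>The Euler--Lagrange equation\<close>

lemma edge_density_update_neighbour:
  assumes xy: "adjacent x y"
  shows "edge_density p (u(x := s)) y = edge_density p u y + (\<bar>s - u y\<bar> powr p - \<bar>u x - u y\<bar> powr p) / 2"
proof -
  have x: "x \<in> {z. adjacent y z}" and ne: "y \<noteq> x"
    using xy adjacent_commute[of x y] by (auto simp: adjacent_def)
  have "(\<Sum>z \<in> {z. adjacent y z} - {x}. \<bar>(u(x := s)) z - (u(x := s)) y\<bar> powr p)
      = (\<Sum>z \<in> {z. adjacent y z} - {x}. \<bar>u z - u y\<bar> powr p)"
    using ne by (intro sum.cong) auto
  then show ?thesis
    unfolding edge_density_def sum.remove[OF finite_adjacent x]
    using ne by (simp add: field_simps)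
qed

lemma edge_density_update_far:
  assumes "\<not> adjacent x y" and "y \<noteq> x"
  shows "edge_density p (u(x := s)) y = edge_density p u y"
  unfolding edge_density_def
  using assms adjacent_commute[of x y] by (intro arg_cong[where f = "\<lambda>t. t / 2"] sum.cong) auto

lemma edge_density_update_self:
  "edge_density p (u(x := s)) x = (\<Sum>y | adjacent x y. \<bar>s - u y\<bar> powr p) / 2"
  unfolding edge_density_def
  by (intro arg_cong[where f = "\<lambda>t. t / 2"] sum.cong) (auto simp: adjacent_def abs_minus_commute)

text \<open>
  The part of the energy that depends on the value \<open>s\<close> at the vertex \<open>x\<close>.  Each edge at \<open>x\<close> occurs with
  weight \<open>1\<close>, being counted with weight \<open>1 / 2\<close> at both of its ends.
\<close>

definition vertex_energy :: "real \<Rightarrow> (int ^ 'n \<Rightarrow> real) \<Rightarrow> (int ^ 'n \<Rightarrow> real) \<Rightarrow> int ^ 'n \<Rightarrow> real \<Rightarrow> real" where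
  "vertex_energy p W u x s =
     (\<Sum>y | adjacent x y. \<bar>s - u y\<bar> powr p) + W x * \<bar>s\<bar> powr p - \<bar>s\<bar> powr p * ln (\<bar>s\<bar> powr p)"

lemma update_integrals:
  fixes u :: "int ^ 'n \<Rightarrow> real"
  assumes p: "p > 0" and u: "finite_entropy p u" and W: "\<And>x. \<bar>W x\<bar> \<le> K"
  shows "finite_entropy p (u(x := s))"
    and "lsum (mass_density p (u(x := s))) = lsum (mass_density p u) + (\<bar>s\<bar> powr p - \<bar>u x\<bar> powr p)"
    and "lsum (energy_density p W (u(x := s))) =
           lsum (energy_density p W u) + (vertex_energy p W u x s - vertex_energy p W u x (u x))"
proof -
  let ?v = "u(x := s)"
  have upd: "lsummable g \<and> lsum g = lsum f + sum (\<lambda>y. g y - f y) A"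
    if "lsummable f" "finite A" "\<And>y. y \<notin> A \<Longrightarrow> g y = f y" for f g :: "int ^ 'n \<Rightarrow> real" and A
  proof -
    have d: "lsummable (\<lambda>y. g y - f y)" "lsum (\<lambda>y. g y - f y) = sum (\<lambda>y. g y - f y) A"
      by (rule finite_support_lsum[OF that(2)]; simp add: that(3))+
    have "g = (\<lambda>y. f y + (g y - f y))" by simp
    then show ?thesis
      using that(1) d by (metis (no_types) Bochner_Integration.integrable_add Bochner_Integration.integral_add)
  qed
  have m: "lsummable (mass_density p ?v) \<and>
      lsum (mass_density p ?v) = lsum (mass_density p u) + sum (\<lambda>y. \<bar>?v y\<bar> powr p - \<bar>u y\<bar> powr p) {x}"
    by (rule upd[OF finite_entropyD(1)[OF u]]) auto
  then show "lsum (mass_density p ?v) = lsum (mass_density p u) + (\<bar>s\<bar> powr p - \<bar>u x\<bar> powr p)"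
    by simp
  have l: "lsummable (log_density p ?v) \<and>
      lsum (log_density p ?v) = lsum (log_density p u) + sum (\<lambda>y. log_density p ?v y - log_density p u y) {x}"
    by (rule upd[OF finite_entropyD(2)[OF u]]) (auto simp: log_density_def)
  show "finite_entropy p ?v"
    using m l by (simp add: finite_entropy_def)
  let ?N = "{y. adjacent x y}"
  have xN: "x \<notin> ?N" by (simp add: adjacent_def)
  have "lsum (energy_density p W ?v) = lsum (energy_density p W u)
      + (\<Sum>y\<in>insert x ?N. energy_density p W ?v y - energy_density p W u y)"
  proof (rule conjunct2[OF upd[OF energy_density_summable(1)[OF p u W]]])
    show "finite (insert x ?N)" by (simp add: finite_adjacent)
    show "energy_density p W ?v y = energy_density p W u y" if "y \<notin> insert x ?N" for y
      using that by (simp add: energy_density_def log_density_def edge_density_update_far)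
  qed
  also have "(\<Sum>y\<in>insert x ?N. energy_density p W ?v y - energy_density p W u y)
      = (energy_density p W ?v x - energy_density p W u x)
        + (\<Sum>y\<in>?N. energy_density p W ?v y - energy_density p W u y)"
    using xN by (simp add: finite_adjacent)
  also have "(\<Sum>y\<in>?N. energy_density p W ?v y - energy_density p W u y)
      = (\<Sum>y\<in>?N. (\<bar>s - u y\<bar> powr p - \<bar>u x - u y\<bar> powr p) / 2)"
  proof (rule sum.cong[OF refl])
    fix y assume "y \<in> ?N"
    then show "energy_density p W ?v y - energy_density p W u y = (\<bar>s - u y\<bar> powr p - \<bar>u x - u y\<bar> powr p) / 2"
      using xN by (auto simp: energy_density_def log_density_def edge_density_update_neighbour)
  qed
  also have "\<dots> = ((\<Sum>y\<in>?N. \<bar>s - u y\<bar> powr p) - (\<Sum>y\<in>?N. \<bar>u x - u y\<bar> powr p)) / 2"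
    by (simp add: sum_divide_distrib flip: sum_subtractf)
  finally have I: "lsum (energy_density p W ?v) = lsum (energy_density p W u)
      + ((energy_density p W ?v x - energy_density p W u x)
        + ((\<Sum>y\<in>?N. \<bar>s - u y\<bar> powr p) - (\<Sum>y\<in>?N. \<bar>u x - u y\<bar> powr p)) / 2)" .
  have "energy_density p W ?v x - energy_density p W u x
      = ((\<Sum>y\<in>?N. \<bar>s - u y\<bar> powr p) - (\<Sum>y\<in>?N. \<bar>u x - u y\<bar> powr p)) / 2
        + (W x * \<bar>s\<bar> powr p - \<bar>s\<bar> powr p * ln (\<bar>s\<bar> powr p))
        - (W x * \<bar>u x\<bar> powr p - \<bar>u x\<bar> powr p * ln (\<bar>u x\<bar> powr p))"
    using edge_density_update_self[of p u x s] edge_density_update_self[of p u x "u x"]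
    by (simp add: energy_density_def log_density_def diff_divide_distrib)
  note I[unfolded this]
  moreover have "(A - B) / 2 + (a - b) - (c - d) + (A - B) / 2 = A + a - b - (B + c - d)" for A B a b c d :: real
    by (simp add: field_simps)
  ultimately show "lsum (energy_density p W ?v) =
      lsum (energy_density p W u) + (vertex_energy p W u x s - vertex_energy p W u x (u x))"
    by (simp only: vertex_energy_def)
qed

lemma DERIV_vertex_energy:
  assumes p: "p > 1"
  shows "(vertex_energy p W u x has_real_derivative
    p * (- p_laplacian p u x + (W x - 1) * \<bar>u x\<bar> powr (p - 2) * u x
         - \<bar>u x\<bar> powr (p - 2) * u x * ln (\<bar>u x\<bar> powr p))) (at (u x))"
proof -
  let ?a = "u x"
  have e: "((\<lambda>s. \<bar>s - u y\<bar> powr p) has_real_derivative p * (\<bar>?a - u y\<bar> powr (p - 2) * (?a - u y))) (at ?a)" for y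
  proof -
    have "((\<lambda>s. s - u y) has_real_derivative 1) (at ?a)"
      by (auto intro!: derivative_eq_intros)
    from DERIV_chain2[OF DERIV_abs_powr[OF p, of "?a - u y"] this] show ?thesis by simp
  qed
  have "(vertex_energy p W u x has_real_derivative
      (\<Sum>y | adjacent x y. p * (\<bar>?a - u y\<bar> powr (p - 2) * (?a - u y)))
      + W x * (p * (\<bar>?a\<bar> powr (p - 2) * ?a))
      - p * (\<bar>?a\<bar> powr (p - 2) * ?a) * (ln (\<bar>?a\<bar> powr p) + 1)) (at ?a)"
    unfolding vertex_energy_def[abs_def]
    by (intro DERIV_diff DERIV_add DERIV_sum DERIV_cmult e DERIV_abs_powr DERIV_abs_powr_ln p)
  moreover have "(\<Sum>y | adjacent x y. p * (\<bar>?a - u y\<bar> powr (p - 2) * (?a - u y))) = p * - p_laplacian p u x"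
    unfolding p_laplacian_def sum_negf[symmetric] sum_distrib_left
    by (intro sum.cong) (auto simp: abs_minus_commute algebra_simps)
  ultimately show ?thesis
    by (simp add: algebra_simps)
qed

text \<open>
  The homogeneous form \<open>I - M S + S ln S \<ge> 0\<close> of the sphere bound is an equality at \<open>u\<close>, so its derivative
  with respect to the single value \<open>u x\<close> vanishes.  The mass \<open>exp (M - 1)\<close> makes \<open>S (ln S - M)\<close>
  stationary, so no Lagrange multiplier survives.
\<close>

lemma minimiser_solves_equation:
  fixes u :: "int ^ 'n \<Rightarrow> real"
  assumes p: "p > 1" and u: "finite_entropy p u" and W: "\<And>x. \<bar>W x\<bar> \<le> K"
    and M: "sphere_bound p W M"
    and S: "lsum (mass_density p u) = exp (M - 1)" and I: "lsum (energy_density p W u) = exp (M - 1)"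
  shows "- p_laplacian p u x + (W x - 1) * \<bar>u x\<bar> powr (p - 2) * u x
    = \<bar>u x\<bar> powr (p - 2) * u x * ln (\<bar>u x\<bar> powr p)"
proof -
  let ?a = "u x"
  have p0: "p > 0" using p by simp
  define R where "R s = exp (M - 1) + (\<bar>s\<bar> powr p - \<bar>?a\<bar> powr p)" for s
  define F where "F s = exp (M - 1) + (vertex_energy p W u x s - vertex_energy p W u x ?a) - M * R s + R s * ln (R s)" for s
  define D where "D = - p_laplacian p u x + (W x - 1) * \<bar>?a\<bar> powr (p - 2) * ?a
         - \<bar>?a\<bar> powr (p - 2) * ?a * ln (\<bar>?a\<bar> powr p)"
  note upd = update_integrals[where x = x and W = W, OF p0 u W]
  have Ra: "R ?a = exp (M - 1)" by (simp add: R_def)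
  have Fa: "F ?a = 0" by (simp add: F_def Ra algebra_simps)
  have F: "0 \<le> F s" if "R s > 0" for s
    proof -
    have R: "lsum (mass_density p (u(x := s))) = R s"
      unfolding upd(2) S R_def ..
    show ?thesis
      using sphere_bound_homogeneous[OF p0 upd(1)[where s = s] W M] that
      unfolding R upd(3) I by (simp add: F_def algebra_simps)
  qed
  let ?R' = "p * (\<bar>?a\<bar> powr (p - 2) * ?a)"
  have R': "(R has_real_derivative ?R') (at ?a)"
    unfolding R_def[abs_def]
    using DERIV_add[OF DERIV_const DERIV_diff[OF DERIV_abs_powr[OF p] DERIV_const]] by simp
  have "(R \<longlongrightarrow> R ?a) (nhds ?a)"
    using DERIV_isCont[OF R'] by (simp add: continuous_at_imp_continuous_at_within isCont_def tendsto_at_iff_tendsto_nhds)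
  then have "\<forall>\<^sub>F s in nhds ?a. 0 < R s"
    by (rule order_tendstoD) (simp add: Ra)
  then obtain d where d: "d > 0" "\<And>s. dist s ?a < d \<Longrightarrow> 0 < R s"
    by (auto simp: eventually_nhds_metric)
  have "((\<lambda>t. t * ln t) has_real_derivative M) (at (R ?a))"
    unfolding Ra by (auto intro!: derivative_eq_intros)
  then have RlnR: "((\<lambda>s. R s * ln (R s)) has_real_derivative M * ?R') (at ?a)"
    by (rule DERIV_chain2) (rule R')
  have vertex: "(vertex_energy p W u x has_real_derivative p * D) (at ?a)"
    unfolding D_def by (rule DERIV_vertex_energy[OF p])
  have "(F has_real_derivative 0 + (p * D - 0) - M * ?R' + M * ?R') (at ?a)"
    unfolding F_def[abs_def]
    by (intro DERIV_add DERIV_diff DERIV_const DERIV_cmult vertex R' RlnR)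
  then have F': "(F has_real_derivative p * D) (at ?a)" by simp
  have "p * D = 0"
    by (rule DERIV_local_min[OF F' d(1)]) (use F Fa d(2) in \<open>auto simp: dist_real_def abs_minus_commute\<close>)
  then show ?thesis using p by (simp add: D_def)
qed

section \<open>Positivity\<close>

text \<open>
  An invariant predicate has a \<open>1\<close>-periodic indicator function, and a \<open>1\<close>-periodic function is
  constant.
\<close>

lemma lattice_connected:
  fixes x y :: "int ^ 'n"
  assumes "P x" and step: "\<And>x y. P x \<Longrightarrow> adjacent x y \<Longrightarrow> P y"
  shows "P y"
proof -
  define g where "g x = (if P x then 1 else 0 :: real)" for x
  have "adjacent x (x + axis i 1)" for x :: "int ^ 'n" and i
  proof -
    have "(\<Sum>j\<in>UNIV. \<bar>x $ j - (x + axis i 1) $ j\<bar>) = (\<Sum>j\<in>UNIV. if j = i then 1 else 0)"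
      by (intro sum.cong) (auto simp: axis_def)
    then show ?thesis by (simp add: adjacent_def)
  qed
  then have "P (x + axis i 1) \<longleftrightarrow> P x" for x i
    using step adjacent_commute by metis
  then have "periodic 1 g"
    by (simp add: periodic_def g_def)
  from periodic_shift[OF this, of x "y - x"] show ?thesis
    using assms(1) by (auto simp: g_def split: if_splits)
qed

text \<open>
  At a zero of \<open>u\<close> the equation says that a sum of nonnegative powers of the neighbouring values
  vanishes, so zeros spread to neighbours and, by connectedness, over the lattice.
\<close>

lemma nonneg_solution_pos:
  fixes u :: "int ^ 'n \<Rightarrow> real"
  assumes nonneg: "\<And>x. 0 \<le> u x" and ne: "u \<noteq> (\<lambda>x. 0)"
    and eq: "\<And>x. - p_laplacian p u x + V x * \<bar>u x\<bar> powr (p - 2) * u x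
      = \<bar>u x\<bar> powr (p - 2) * u x * ln (\<bar>u x\<bar> powr p)"
  shows "u x > 0"
proof (rule ccontr)
  assume "\<not> u x > 0"
  then have x: "u x = 0" using nonneg[of x] by simp
  have "u z = 0" if y: "u y = 0" and yz: "adjacent y z" for y z
  proof -
    have "(\<Sum>z | adjacent y z. \<bar>u z\<bar> powr (p - 2) * u z) = 0"
      using eq[of y] y by (simp add: p_laplacian_def)
    then have "\<bar>u z\<bar> powr (p - 2) * u z = 0"
      using yz by (subst (asm) sum_nonneg_eq_0_iff) (auto simp: finite_adjacent nonneg)
    then show ?thesis by simp
  qed
  then have "u y = 0" for y
    using lattice_connected[where P = "\<lambda>x. u x = 0" and x = x] x by blast
  then show False using ne by auto
qed

lemma abs_integrals:
  assumes p: "p > 0" and u: "finite_entropy p u" and W: "\<And>x. \<bar>W x\<bar> \<le> K"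
  shows "finite_entropy p (\<lambda>x. \<bar>u x\<bar>)"
    and "lsum (energy_density p W (\<lambda>x. \<bar>u x\<bar>)) \<le> lsum (energy_density p W u)"
proof -
  have l: "log_density p (\<lambda>x. \<bar>u x\<bar>) = log_density p u"
    by (simp add: log_density_def fun_eq_iff)
  show fe: "finite_entropy p (\<lambda>x. \<bar>u x\<bar>)"
    using u by (simp add: finite_entropy_def l)
  have "edge_density p (\<lambda>x. \<bar>u x\<bar>) x \<le> edge_density p u x" for x
    unfolding edge_density_def using p
    by (intro divide_right_mono sum_mono powr_mono2) auto
  then show "lsum (energy_density p W (\<lambda>x. \<bar>u x\<bar>)) \<le> lsum (energy_density p W u)"
    by (intro lsum_mono energy_density_summable(1)[OF p fe W] energy_density_summable(1)[OF p u W])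
       (simp add: energy_density_def l)
qed

section \<open>The ground state\<close>

theorem theorem6p5:
  fixes p :: real and V Vp :: "int ^ 'n \<Rightarrow> real" and T :: nat
  assumes "p > 1"
    and "T > 0" and "periodic T Vp"
    and "- 1 < (INF x. ereal (V x))"
    and "\<And>x. V x \<le> Vp x"
    and "((\<lambda>x. \<bar>V x - Vp x\<bar>) \<longlongrightarrow> 0) (filtercomap lattice_norm at_top)"
  shows "\<exists>u. ground_state p V u \<and> ((\<forall>x. u x > 0) \<or> (\<forall>x. u x < 0))"
proof -
  have p0: "p > 0" using assms(1) by simp
  \<comment> \<open>The weight \<open>V + 1\<close> is nonnegative, unlike \<open>V\<close>.\<close>
  define W where "W x = V x + 1" for x
  have W0: "0 \<le> W x" for x
  proof -
    have "- 1 < ereal (V x)"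
      using less_le_trans[OF assms(4) INF_lower[of x]] by simp
    also have "ereal (V x) = - ereal (- V x)" by simp
    finally have "ereal (- V x) < 1"
      by (simp only: ereal_minus_less_minus)
    then show ?thesis by (simp add: W_def)
  qed
  obtain K where K: "\<And>x. Vp x \<le> K"
    using periodic_bounded[OF assms(3,2)] by blast
  have WK: "W x \<le> K + 1" for x
    using assms(5)[of x] K[of x] by (simp add: W_def)
  have W: "\<bar>W x\<bar> \<le> K + 1" for x
    using W0 WK by simp
  then have V: "\<bar>V x + 1\<bar> \<le> K + 1" for x
    by (simp add: W_def)
  have W_eq: "(\<lambda>x. V x + 1) = W" by (simp add: W_def fun_eq_iff)
  have per: "periodic T (\<lambda>x. Vp x + 1)"
    using assms(3) by (simp add: periodic_def)
  have le: "W x \<le> Vp x + 1" for x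
    using assms(5) by (simp add: W_def)
  have lim: "((\<lambda>x. \<bar>W x - (Vp x + 1)\<bar>) \<longlongrightarrow> 0) (filtercomap lattice_norm at_top)"
    using assms(6) by (simp add: W_def)
  obtain M w where M: "sphere_bound p W M" and w: "finite_entropy p w" "lsum (mass_density p w) = 1"
    and Iw: "lsum (energy_density p W w) \<le> M"
    using ex_minimiser_on_sphere[where W = W, OF assms(1,2) per W0 WK le lim] by blast
  \<comment> \<open>The rescaled minimiser has energy sum \<open>s * M - s * ln s\<close> and mass \<open>s\<close>; they agree, as the Nehari
    manifold requires, exactly for this \<open>s\<close>.\<close>
  define s where "s = exp (M - 1)"
  have s: "s > 0" by (simp add: s_def)
  define u where "u = rescale p s (\<lambda>x. \<bar>w x\<bar>)"
  note a = abs_integrals[where W = W, OF p0 w(1) W]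
  have Sa: "lsum (mass_density p (\<lambda>x. \<bar>w x\<bar>)) = 1"
    using w(2) by simp
  then have "M \<le> lsum (energy_density p W (\<lambda>x. \<bar>w x\<bar>))"
    using M a(1) unfolding sphere_bound_def by blast
  then have Ia: "lsum (energy_density p W (\<lambda>x. \<bar>w x\<bar>)) = M"
    using a(2) Iw by simp
  note r = rescale_integrals[where W = W, OF p0 s a(1) W, folded u_def]
  have fu: "finite_entropy p u" by (rule r)
  have Su: "lsum (mass_density p u) = exp (M - 1)"
    using r(2) Sa by (simp add: s_def)
  have Iu: "lsum (energy_density p W u) = exp (M - 1)"
    using r(3) Sa Ia by (simp add: s_def algebra_simps)
  have u0: "u \<noteq> (\<lambda>x. 0)"
    using Su by auto
  have sol: "- p_laplacian p u x + V x * \<bar>u x\<bar> powr (p - 2) * u x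
      = \<bar>u x\<bar> powr (p - 2) * u x * ln (\<bar>u x\<bar> powr p)" for x
    using minimiser_solves_equation[OF assms(1) fu W M Su Iu, of x] by (simp add: W_def)
  have pos: "u x > 0" for x
    by (rule nonneg_solution_pos[OF _ u0 sol]) (simp add: u_def rescale_def)
  have nehari: "u \<in> nehari p V"
    using fu u0 Su Iu by (simp add: nehari_iff[OF p0 V] W_eq)
  have energy_nehari: "energy p V v = ereal (lsum (mass_density p v) / p)" if "v \<in> nehari p V" for v
    using that energy_domain_iff(2)[OF p0 V, of v] by (simp add: nehari_iff[OF p0 V])
  have least: "energy p V u \<le> energy p V v" if v: "v \<in> nehari p V" for v
  proof -
    let ?S = "lsum (mass_density p v)"
    have fv: "finite_entropy p v" and v0: "v \<noteq> (\<lambda>x. 0)" and Iv: "lsum (energy_density p W v) = ?S"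
      using v by (auto simp: nehari_iff[OF p0 V] W_eq)
    obtain x where "v x \<noteq> 0" using v0 by auto
    then have S: "?S > 0"
      using mass_density_le_lsum[OF finite_entropyD(1)[OF fv], of x]
      by (smt (verit) powr_gt_zero zero_less_abs_iff)
    have "?S * (M - ln ?S) \<le> ?S * 1"
      using sphere_bound_homogeneous[OF p0 fv W M S] Iv by simp
    then have "M - 1 \<le> ln ?S"
      using S by (simp only: mult_le_cancel_left_pos)
    then have "exp (M - 1) \<le> ?S"
      using S by (simp add: ln_ge_iff)
    then show ?thesis
      using p0 by (simp add: energy_nehari[OF v] energy_nehari[OF nehari] Su divide_right_mono)
  qed
  have "energy p V u = (INF v\<in>nehari p V. energy p V v)"
    by (intro antisym INF_greatest least INF_lower nehari)
  then have "ground_state p V u"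
    using energy_domain_iff(1)[OF p0 V, of u] fu sol u0 by (simp add: ground_state_def solution_def)
  then show ?thesis using pos by blast
qed

end
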